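(* Let $\phi:\{0,1,2,\dots\}\to[0,\infty)$ be strictly increasing with $\phi(0)=0$, $\lim_{n\to\infty}\phi(n)=\infty$, $\lim_{n\to\infty}\frac{\phi(n)}{\phi(n+1)}=1$, and such that the sequence $\{\phi(n)-\phi(n-1):n\ge 1\}$ is non-increasing. Put $L(n):=\sum_{k=1}^n\frac{\phi(k)-\phi(k-1)}{\phi(k)}$ for $n\ge 1$ and assume $\lim_{n\to\infty}L(n)=\infty$. Let $\nu\in(0,\infty)$ and set $\pi_k:=\left(\frac{\phi(k-1)}{\phi(k)}\right)^\nu$ for $k\ge 1$. Let $\{R_n:n\ge 1\}$ be independent random variables with values in the nonnegative integers, and write $q_n^{(j)}:=P(R_n=j)$ for $j\ge 0$. Assume: (a) there is a sequence of functions $f_n:[0,1]\to[0,1]$, $n\ge 1$, such that, uniformly in $n$, $$\lim_{x\uparrow 1}f_n(x)=f_n(1)=1\quad\text{and}\quad\lim_{x\uparrow 1}\frac{f_n(x)-1}{x-1}=1,$$ and such that for every $k\ge 1$ $$q_k^{(0)}=f_k(\pi_k)\quad\text{and}\quad q_k^{(1)}=f_k(\pi_k)(1-\pi_k);$$ (b) $\mathbb{E}[e^{\theta R_n}]<\infty$ for every $\theta>0$ and every $n\ge 1$; (c) for every $\theta>0$ there exist $C_\theta>0$ and an integer $k_\theta\ge 1$ such that $$0\le\sup_{0<|\tau|\le\theta}\Big\{\mathbb{E}[e^{\tau R_k}]-\big(q_k^{(0)}+e^{\tau}q_k^{(1)}\big)\Big\}\le C_\theta\,(1-q_k^{(0)})^2\quad\text{for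 every }k>k_\theta.$$ Define, for $n\ge 1$, $$W_n:=\frac{1}{\phi(n)}\sum_{k=1}^n\phi(k)R_k,\qquad Z_n:=\frac{1}{L(n)}\sum_{k=1}^n\frac{\phi(k)-\phi(k-1)}{\phi(k)}W_k.$$ Then the sequence $\{Z_n:n\ge 1\}$ satisfies the large deviation principle on $\mathbb{R}$ with speed function $v_n=L(n)$ and good rate function $I$ given by $$I(x):=\begin{cases}x\log\frac{x}{\nu}-x+\nu&\text{if }x\ge 0,\\ \infty&\text{if }x<0,\end{cases}$$ where $0\log 0=0$.
   Context: A sequence of real-valued random variables $\{Z_n:n\ge1\}$ satisfies the large deviation principle with speed function $v_n$ and rate function $I$ if: $\lim_{n\to\infty}v_n=\infty$; $I:\mathbb{R}\to[0,\infty]$ is lower semi-continuous; $\limsup_{n\to\infty}\frac{1}{v_n}\log P(Z_n\in F)\le-\inf_{z\in F}I(z)$ for all closed sets $F\subseteq\mathbb{R}$; and $\liminf_{n\to\infty}\frac{1}{v_n}\log P(Z_n\in G)\ge-\inf_{z\in G}I(z)$ for all open sets $G\subseteq\mathbb{R}$. The rate function $I$ is good if its level sets $\{z:I(z)\le\eta\}$ are compact for all $\eta\ge0$. "Uniformly in $n$" in (a) means: $f_n(1)=1$ for all $n$, and for every $\varepsilon>0$ there is $\delta>0$ such that for all $n\ge1$ and all $x\in[0,1]$ with $1-\delta<x<1$ one has $|f_n(x)-1|<\varepsilon$ and $\left|\frac{f_n(x)-1}{x-1}-1\right|<\varepsilon$. *)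

theory Defs
  imports "HOL-Probability.Probability"
begin

definition ln_prob :: "real \<Rightarrow> ereal" where
  "ln_prob p = (if p = 0 then -\<infinity> else ereal (ln p))"

definition lower_semicontinuous :: "(real \<Rightarrow> ereal) \<Rightarrow> bool" where
  "lower_semicontinuous I \<longleftrightarrow> (\<forall>x. I x \<le> Liminf (at x) I)"

(* Only the indices n >= 1 of the sequences matter; the values Z 0 and v 0 are irrelevant. *)
definition satisfies_LDP ::
  "'w measure \<Rightarrow> (nat \<Rightarrow> 'w \<Rightarrow> real) \<Rightarrow> (nat \<Rightarrow> real) \<Rightarrow> (real \<Rightarrow> ereal) \<Rightarrow> bool" where
  "satisfies_LDP M Z v I \<longleftrightarrow>
     (\<forall>n\<ge>1. Z n \<in> borel_measurable M) \<and>
     filterlim v at_top sequentially \<and>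
     (\<forall>x. 0 \<le> I x) \<and> lower_semicontinuous I \<and>
     (\<forall>F. closed F \<longrightarrow>
        limsup (\<lambda>n. ereal (1 / v n) * ln_prob (measure M {\<omega> \<in> space M. Z n \<omega> \<in> F}))
          \<le> - (INF z\<in>F. I z)) \<and>
     (\<forall>G. open G \<longrightarrow>
        - (INF z\<in>G. I z)
          \<le> liminf (\<lambda>n. ereal (1 / v n) * ln_prob (measure M {\<omega> \<in> space M. Z n \<omega> \<in> G})))"

definition good_rate_function :: "(real \<Rightarrow> ereal) \<Rightarrow> bool" where
  "good_rate_function I \<longleftrightarrow> (\<forall>\<eta>::real. 0 \<le> \<eta> \<longrightarrow> compact {z. I z \<le> ereal \<eta>})"

definition L_sum :: "(nat \<Rightarrow> real) \<Rightarrow> nat \<Rightarrow> real" where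
  "L_sum \<phi> n = (\<Sum>k=1..n. (\<phi> k - \<phi> (k - 1)) / \<phi> k)"

(* For k = 1 the base is 0 and powr gives 0, as it should since \<nu> > 0. *)
definition pi_seq :: "(nat \<Rightarrow> real) \<Rightarrow> real \<Rightarrow> nat \<Rightarrow> real" where
  "pi_seq \<phi> \<nu> k = (\<phi> (k - 1) / \<phi> k) powr \<nu>"

definition W_seq :: "(nat \<Rightarrow> real) \<Rightarrow> (nat \<Rightarrow> 'w \<Rightarrow> nat) \<Rightarrow> nat \<Rightarrow> 'w \<Rightarrow> real" where
  "W_seq \<phi> R n \<omega> = (1 / \<phi> n) * (\<Sum>k=1..n. \<phi> k * real (R k \<omega>))"

definition Z_seq :: "(nat \<Rightarrow> real) \<Rightarrow> (nat \<Rightarrow> 'w \<Rightarrow> nat) \<Rightarrow> nat \<Rightarrow> 'w \<Rightarrow> real" where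
  "Z_seq \<phi> R n \<omega> =
     (1 / L_sum \<phi> n) * (\<Sum>k=1..n. (\<phi> k - \<phi> (k - 1)) / \<phi> k * W_seq \<phi> R k \<omega>)"

(* The limits f n x --> f n 1 = 1 and (f n x - 1) / (x - 1) --> 1 as x increases to 1,
   uniformly in n >= 1. *)
definition uniformly_tangent_at_1 :: "(nat \<Rightarrow> real \<Rightarrow> real) \<Rightarrow> bool" where
  "uniformly_tangent_at_1 f \<longleftrightarrow>
     (\<forall>n\<ge>1. f n 1 = 1) \<and>
     (\<forall>\<epsilon>>0. \<exists>\<delta>>0. \<forall>n\<ge>1. \<forall>x\<in>{0..1}. 1 - \<delta> < x \<and> x < 1 \<longrightarrow>
        \<bar>f n x - 1\<bar> < \<epsilon> \<and> \<bar>(f n x - 1) / (x - 1) - 1\<bar> < \<epsilon>)"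

(* 0 log 0 = 0 holds here because the factor x is 0. *)
definition poisson_rate :: "real \<Rightarrow> real \<Rightarrow> ereal" where
  "poisson_rate \<nu> x = (if 0 \<le> x then ereal (x * ln (x / \<nu>) - x + \<nu>) else \<infinity>)"

end

theory Submission
  imports Defs "HOL-Real_Asymp.Real_Asymp"
begin

text \<open>
  Put \<open>a k = (\<phi> k - \<phi> (k - 1)) / \<phi> k\<close>, so that \<open>L n = a 1 + \<dots> + a n\<close>. Exchanging the two summations,
  \<open>L n * Z n\<close> is a linear combination of the independent variables \<open>R j\<close> with coefficients
  \<open>w n j = \<phi> j * (\<Sum>k=j..n. a k / \<phi> k)\<close>. Comparing this sum with telescoping sums of \<open>1 / \<phi>\<close>, where
  the lower bound uses the concavity of \<open>\<phi>\<close>, gives \<open>1 - \<phi> j / \<phi> (n + 1) \<le> w n j \<le> 1 + a j\<close>; hence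
  \<open>w n j\<close> is close to 1 on average with respect to the weights \<open>a j\<close>. The hypotheses on \<open>R j\<close> give
  \<open>ln E[exp (\<tau> R j)] = \<nu> a j (exp \<tau> - 1) + o(a j)\<close> locally uniformly in \<open>\<tau>\<close>, so the scaled logarithmic
  moment generating function of \<open>Z n\<close> converges to \<open>\<nu> (exp \<theta> - 1)\<close>, and the large deviation principle
  follows as in the Gaertner-Ellis theorem.
\<close>

section \<open>From exponential bounds to limits on the logarithmic scale\<close>

text \<open>A factor \<open>K\<close> costs only about \<open>ln K / v n\<close>, which vanishes in
  the limit. Quantifying over real \<open>c\<close> below \<open>m\<close> covers
  \<open>m = \<infinity>\<close> as well.\<close>

lemma limsup_ln_prob_le:
  fixes v p :: "nat \<Rightarrow> real" and m :: ereal
  assumes v: "filterlim v at_top sequentially" and p: "\<And>n. 0 \<le> p n"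
    and bound: "\<And>c. ereal c < m \<Longrightarrow> \<exists>K. \<forall>\<^sub>F n in sequentially. p n \<le> K * exp (- c * v n)"
  shows "limsup (\<lambda>n. ereal (1 / v n) * ln_prob (p n)) \<le> - m"
  unfolding Limsup_le_iff
proof (intro allI impI)
  fix y assume "- m < y"
  then have "- y < m" by (simp add: ereal_uminus_less_reorder)
  then obtain c where c: "- y < ereal c" "ereal c < m" using ereal_dense2 by blast
  \<comment> \<open>The gap between \<open>c'\<close> and \<open>c\<close> is what absorbs the
    constant: \<open>(c - c') * v n\<close> eventually exceeds \<open>ln B\<close>.\<close>
  obtain c' where c': "- y < ereal c'" "c' < c" using ereal_dense2[OF c(1)] by auto
  obtain K where K: "\<forall>\<^sub>F n in sequentially. p n \<le> K * exp (- c * v n)"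
    using bound[OF c(2)] by blast
  \<comment> \<open>\<open>K\<close> may be zero or negative; with \<open>B \<ge> 1\<close> the
    logarithm is meaningful.\<close>
  define B where "B = max K 1"
  have "\<forall>\<^sub>F n in sequentially. v n > max 0 (ln B / (c - c'))"
    using v filterlim_at_top_dense by blast
  with K show "\<forall>\<^sub>F n in sequentially. ereal (1 / v n) * ln_prob (p n) < y"
  proof eventually_elim
    case (elim n)
    have v0: "0 < v n" using elim(2) by simp
    show ?case
    proof (cases "p n = 0")
      case True
      have "- y \<noteq> \<infinity>" using c(1) by auto
      then show ?thesis using v0 True by (auto simp: ln_prob_def ereal_uminus_eq_reorder)
    next
      case False
      have "0 < p n" using p[of n] False by simp
      moreover have "p n \<le> B * exp (- c * v n)"
        using elim(1) by (rule order_trans) (simp add: B_def)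
      ultimately have "ln (p n) \<le> ln (B * exp (- c * v n))"
        by (subst ln_le_cancel_iff) auto
      also have "\<dots> = ln B - c * v n"
        by (subst ln_mult_pos) (auto simp: B_def)
      also have "\<dots> < - c' * v n"
        using elim(2) c'(2) by (simp add: field_simps)
      finally have "1 / v n * ln (p n) < - c'" using v0 by (simp add: field_simps)
      moreover have "ereal (- c') < y" using c'(1) by (simp add: ereal_uminus_less_reorder flip: uminus_ereal.simps(1))
      ultimately have "ereal (1 / v n * ln (p n)) < y" by (meson ereal_less_eq(3) less_imp_le order.strict_trans1)
      then show ?thesis using False by (simp add: ln_prob_def)
    qed
  qed
qed

text \<open>Lower counterpart. No constant appears in front of the exponential because
  \<open>c\<close> lies strictly above \<open>m\<close>, and this slack can absorb constants
  beforehand.\<close>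

lemma liminf_ln_prob_ge:
  fixes v p :: "nat \<Rightarrow> real" and m :: ereal
  assumes v: "filterlim v at_top sequentially"
    and bound: "\<And>c. m < ereal c \<Longrightarrow> \<forall>\<^sub>F n in sequentially. exp (- c * v n) \<le> p n"
  shows "- m \<le> liminf (\<lambda>n. ereal (1 / v n) * ln_prob (p n))"
  unfolding le_Liminf_iff
proof (intro allI impI)
  fix y assume "y < - m"
  then have "m < - y" by (simp add: ereal_less_uminus_reorder)
  then obtain c where c: "m < ereal c" "ereal c < - y" using ereal_dense2 by blast
  have "\<forall>\<^sub>F n in sequentially. v n > 0" using v filterlim_at_top_dense by blast
  with bound[OF c(1)] show "\<forall>\<^sub>F n in sequentially. y < ereal (1 / v n) * ln_prob (p n)"
  proof eventually_elim
    case (elim n)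
    have p: "0 < p n" using elim(1) by (meson exp_gt_zero less_le_trans)
    have "- c * v n \<le> ln (p n)" using elim(1) p by (simp add: ln_ge_iff)
    then have "- c \<le> 1 / v n * ln (p n)" using elim(2) by (simp add: field_simps)
    moreover have "y < ereal (- c)" using c(2) by (simp add: ereal_less_uminus_reorder flip: uminus_ereal.simps(1))
    ultimately have "y < ereal (1 / v n * ln (p n))" by (meson ereal_less_eq(3) less_le_trans)
    then show ?case using p by (simp add: ln_prob_def)
  qed
qed

section \<open>Tilted tail estimates and the local lower bound\<close>

context prob_space
begin

text \<open>Exponential Chebyshev inequality under the weight \<open>exp (a * X)\<close>: on the
  event, \<open>1 \<le> exp (b * (X - x))\<close>. The sign of \<open>b\<close> selects the upper or
  the lower tail, and \<open>a = 0\<close> is the usual Chernoff bound.\<close>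

lemma tilted_tail_le:
  fixes X :: "'a \<Rightarrow> real"
  assumes [measurable]: "X \<in> borel_measurable M"
    and int: "\<And>s. integrable M (\<lambda>\<omega>. exp (s * X \<omega>))"
  shows "(\<integral>\<omega>. exp (a * X \<omega>) * indicator {\<omega>. 0 \<le> b * (X \<omega> - x)} \<omega> \<partial>M)
     \<le> exp (- b * x) * (\<integral>\<omega>. exp ((a + b) * X \<omega>) \<partial>M)"
proof -
  have "(\<integral>\<omega>. exp (a * X \<omega>) * indicator {\<omega>. 0 \<le> b * (X \<omega> - x)} \<omega> \<partial>M)
     \<le> (\<integral>\<omega>. exp (- b * x) * exp ((a + b) * X \<omega>) \<partial>M)"
  proof (rule integral_mono)
    show "integrable M (\<lambda>\<omega>. exp (a * X \<omega>) * indicator {\<omega>. 0 \<le> b * (X \<omega> - x)} \<omega>)"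
      by (rule Bochner_Integration.integrable_bound[OF int[of a]]) (auto simp: indicator_def)
    show "integrable M (\<lambda>\<omega>. exp (- b * x) * exp ((a + b) * X \<omega>))" using int by simp
    show "exp (a * X \<omega>) * indicator {\<omega>. 0 \<le> b * (X \<omega> - x)} \<omega> \<le> exp (- b * x) * exp ((a + b) * X \<omega>)"
      if "\<omega> \<in> space M" for \<omega>
      by (auto simp: indicator_def algebra_simps simp flip: exp_add)
  qed
  then show ?thesis by simp
qed

text \<open>Chebyshev with parameters of order \<open>v n\<close> leaves
  \<open>exp (- t * v n * x)\<close> times a moment of size \<open>exp (v n * (l + o(1)))\<close>.
  The case \<open>\<theta> = 0\<close> yields the bound for closed sets, general
  \<open>\<theta>\<close> the tails to be subtracted for open sets.\<close>

lemma eventually_tilted_tail_le: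
  fixes Z :: "nat \<Rightarrow> 'a \<Rightarrow> real" and v :: "nat \<Rightarrow> real"
  assumes meas: "\<And>n. 1 \<le> n \<Longrightarrow> Z n \<in> borel_measurable M"
    and int: "\<And>n s. 1 \<le> n \<Longrightarrow> integrable M (\<lambda>\<omega>. exp (s * Z n \<omega>))"
    and v: "filterlim v at_top sequentially"
    and lim: "(\<lambda>n. ln (\<integral>\<omega>. exp ((\<theta> + t) * v n * Z n \<omega>) \<partial>M) / v n) \<longlonglongrightarrow> l"
    and c: "c < t * x - l"
  shows "\<forall>\<^sub>F n in sequentially.
     (\<integral>\<omega>. exp (\<theta> * v n * Z n \<omega>) * indicator {\<omega>. 0 \<le> t * (Z n \<omega> - x)} \<omega> \<partial>M) \<le> exp (- c * v n)"
proof -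
  have "\<forall>\<^sub>F n in sequentially. ln (\<integral>\<omega>. exp ((\<theta> + t) * v n * Z n \<omega>) \<partial>M) / v n < t * x - c"
    using lim c by (intro order_tendstoD) auto
  moreover have "\<forall>\<^sub>F n in sequentially. v n > 0" using v filterlim_at_top_dense by blast
  ultimately show ?thesis using eventually_ge_at_top[of 1]
  proof eventually_elim
    case (elim n)
    let ?E = "\<integral>\<omega>. exp ((\<theta> + t) * v n * Z n \<omega>) \<partial>M"
    have "0 \<le> (t * v n) * y \<longleftrightarrow> 0 \<le> t * y" for y
      using mult_le_cancel_left_pos[OF elim(2), of 0 "t * y"] by (simp only: mult_zero_left mult_zero_right mult_ac)
    then have "(\<integral>\<omega>. exp (\<theta> * v n * Z n \<omega>) * indicator {\<omega>. 0 \<le> t * (Z n \<omega> - x)} \<omega> \<partial>M)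
       \<le> exp (- (t * v n) * x) * (\<integral>\<omega>. exp ((\<theta> * v n + t * v n) * Z n \<omega>) \<partial>M)"
      using tilted_tail_le[OF meas[OF elim(3)] int[OF elim(3)], of "\<theta> * v n" "t * v n" x] by (simp only:)
    also have "\<dots> = exp (- (t * v n) * x) * ?E" by (simp add: algebra_simps)
    also have "\<dots> \<le> exp (- (t * v n) * x) * exp (v n * (t * x - c))"
    proof (rule mult_left_mono)
      have E: "0 < ?E" using int[OF elim(3), of "(\<theta> + t) * v n"] by (rule expectation_greater) simp
      have "ln ?E \<le> v n * (t * x - c)" using elim(1,2) by (simp add: field_simps)
      then show "?E \<le> exp (v n * (t * x - c))"
        using exp_le_cancel_iff[of "ln ?E"] E by (simp only: exp_ln)
    qed simp
    also have "\<dots> = exp (- c * v n)" by (simp add: algebra_simps flip: exp_add)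
    finally show ?case .
  qed
qed

text \<open>
  No change of measure is needed: \<open>E[exp (\<theta> v Z)]\<close> minus the two tilted tails away from \<open>x\<close>, which
  are exponentially smaller because \<open>\<Lambda>\<close> is differentiable at \<open>\<theta>\<close>, bounds
  \<open>E[exp (\<theta> v Z); \<bar>Z - x\<bar> < \<delta>]\<close> from below.
\<close>

lemma eventually_prob_ge:
  fixes Z :: "nat \<Rightarrow> 'a \<Rightarrow> real" and v :: "nat \<Rightarrow> real" and \<Lambda> :: "real \<Rightarrow> real"
  assumes meas: "\<And>n. 1 \<le> n \<Longrightarrow> Z n \<in> borel_measurable M"
    and int: "\<And>n s. 1 \<le> n \<Longrightarrow> integrable M (\<lambda>\<omega>. exp (s * Z n \<omega>))"
    and v: "filterlim v at_top sequentially"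
    and lim: "\<And>\<theta>. (\<lambda>n. ln (\<integral>\<omega>. exp (\<theta> * v n * Z n \<omega>) \<partial>M) / v n) \<longlonglongrightarrow> \<Lambda> \<theta>"
    and deriv: "(\<Lambda> has_real_derivative x) (at \<theta>)"
    and G: "open G" "x \<in> G" and c: "\<theta> * x - \<Lambda> \<theta> < c"
  shows "\<forall>\<^sub>F n in sequentially. exp (- c * v n) \<le> measure M {\<omega> \<in> space M. Z n \<omega> \<in> G}"
proof -
  \<comment> \<open>A quarter of the available slack. One share each pays for the variation of
    \<open>exp (\<theta> * v n * z)\<close> near \<open>x\<close>, for the error
    \<open>\<zeta>\<close> in the limit and for a factor 2.\<close>
  define \<eta> where "\<eta> = (c - \<theta> * x + \<Lambda> \<theta>) / 4"
  have \<eta>: "0 < \<eta>" using c by (simp add: \<eta>_def)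
  obtain \<delta>\<^sub>0 where \<delta>\<^sub>0: "0 < \<delta>\<^sub>0" "ball x \<delta>\<^sub>0 \<subseteq> G" using G open_contains_ball by blast
  \<comment> \<open>On the ball of radius \<open>\<delta>\<close> the exponent
    \<open>\<theta> * z\<close> exceeds \<open>\<theta> * x\<close> by at most
    \<open>\<eta>\<close>; the summand 1 covers \<open>\<theta> = 0\<close>.\<close>
  define \<delta> where "\<delta> = min \<delta>\<^sub>0 (\<eta> / (\<bar>\<theta>\<bar> + 1))"
  have \<delta>: "0 < \<delta>" "\<bar>\<theta>\<bar> * \<delta> \<le> \<eta>" "ball x \<delta> \<subseteq> G"
  proof -
    show "0 < \<delta>" using \<delta>\<^sub>0 \<eta> by (simp add: \<delta>_def)
    have "\<bar>\<theta>\<bar> * \<delta> \<le> (\<bar>\<theta>\<bar> + 1) * (\<eta> / (\<bar>\<theta>\<bar> + 1))"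
      using \<open>0 < \<delta>\<close> by (intro mult_mono) (auto simp: \<delta>_def)
    then show "\<bar>\<theta>\<bar> * \<delta> \<le> \<eta>" by simp
    show "ball x \<delta> \<subseteq> G" using \<delta>\<^sub>0 by (auto simp: \<delta>_def)
  qed
  have "(\<lambda>h. (\<Lambda> (\<theta> + h) - \<Lambda> \<theta>) / h) \<midarrow>0\<rightarrow> x" using deriv by (simp add: DERIV_def)
  then obtain d where d: "0 < d" "\<And>h. h \<noteq> 0 \<Longrightarrow> \<bar>h\<bar> < d \<Longrightarrow> \<bar>(\<Lambda> (\<theta> + h) - \<Lambda> \<theta>) / h - x\<bar> < \<delta>"
    using \<delta>(1) unfolding LIM_def by (auto simp: dist_real_def)
  define t where "t = d / 2"
  have t: "0 < t" using d by (simp add: t_def)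
  \<comment> \<open>Differentiability at \<open>\<theta>\<close> enters here: difference quotients
    within \<open>\<delta>\<close> of \<open>x\<close> make the tilted mass beyond
    \<open>x + \<delta>\<close>, and likewise below \<open>x - \<delta>\<close>, decay strictly
    faster than the total mass \<open>exp (v n * \<Lambda> \<theta>)\<close>.\<close>
  have t1: "- \<Lambda> \<theta> < t * (x + \<delta>) - \<Lambda> (\<theta> + t)"
    using d(2)[of t] t by (auto simp: t_def abs_if field_simps split: if_splits)
  have t2: "- \<Lambda> \<theta> < - t * (x - \<delta>) - \<Lambda> (\<theta> + - t)"
    using d(2)[of "- t"] t by (auto simp: t_def abs_if field_simps split: if_splits)
  \<comment> \<open>One rate \<open>\<kappa>\<close> serves both tails.\<close>
  obtain \<kappa> where \<kappa>: "- \<Lambda> \<theta> < \<kappa>" "\<kappa> < t * (x + \<delta>) - \<Lambda> (\<theta> + t)" "\<kappa> < - t * (x - \<delta>) - \<Lambda> (\<theta> + - t)"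
    using dense[of "- \<Lambda> \<theta>" "min (t * (x + \<delta>) - \<Lambda> (\<theta> + t)) (- t * (x - \<delta>) - \<Lambda> (\<theta> + - t))"] t1 t2 by auto
  \<comment> \<open>At most half of the gap between \<open>\<kappa>\<close> and
    \<open>- \<Lambda> \<theta>\<close>, so that
    \<open>exp (v n * (\<Lambda> \<theta> - \<zeta>))\<close> still dominates the tails.\<close>
  define \<zeta> where "\<zeta> = min \<eta> ((\<kappa> + \<Lambda> \<theta>) / 2)"
  have \<zeta>: "0 < \<zeta>" "\<zeta> \<le> \<eta>" "0 < \<Lambda> \<theta> - \<zeta> + \<kappa>" using \<eta> \<kappa>(1) by (auto simp: \<zeta>_def min_def field_simps)
  have tail: "\<forall>\<^sub>F n in sequentially.
     (\<integral>\<omega>. exp (\<theta> * v n * Z n \<omega>) * indicator {\<omega>. 0 \<le> s * (Z n \<omega> - y)} \<omega> \<partial>M) \<le> exp (- \<kappa> * v n)"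
    if "\<kappa> < s * y - \<Lambda> (\<theta> + s)" for s y
    using meas int by (rule eventually_tilted_tail_le[OF _ _ v lim that])
  have "\<forall>\<^sub>F n in sequentially. \<Lambda> \<theta> - \<zeta> < ln (\<integral>\<omega>. exp (\<theta> * v n * Z n \<omega>) \<partial>M) / v n"
    using lim[of \<theta>] \<zeta>(1) by (intro order_tendstoD) auto
  \<comment> \<open>The threshold with \<open>ln 4\<close> makes the two tails together at most half
    of the total; the one with \<open>ln 2\<close> pays for the resulting factor 2.\<close>
  moreover have "\<forall>\<^sub>F n in sequentially. v n > max 0 (max (ln 4 / (\<Lambda> \<theta> - \<zeta> + \<kappa>)) (ln 2 / \<eta>))"
    using v filterlim_at_top_dense by blast
  ultimately show ?thesis using tail[OF \<kappa>(2)] tail[OF \<kappa>(3)] eventually_ge_at_top[of 1]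
  proof eventually_elim
    case (elim n)
    have v0: "0 < v n" using elim(2) by simp
    note [measurable] = meas[OF elim(5)]
    let ?X = "\<lambda>\<omega>. exp (\<theta> * v n * Z n \<omega>)"
    let ?A = "{\<omega>. 0 \<le> t * (Z n \<omega> - (x + \<delta>))}" and ?B = "{\<omega>. 0 \<le> - t * (Z n \<omega> - (x - \<delta>))}"
    let ?D = "{\<omega> \<in> space M. Z n \<omega> \<in> ball x \<delta>}"
    let ?K = "exp ((\<theta> * x + \<eta>) * v n)"
    have iX: "integrable M ?X" using int[OF elim(5)] by simp
    have iI: "integrable M (\<lambda>\<omega>. ?X \<omega> * indicator S \<omega>)" if [measurable]: "Measurable.pred M (\<lambda>\<omega>. \<omega> \<in> S)" for S
      by (rule Bochner_Integration.integrable_bound[OF iX]) (auto simp: indicator_def)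
    have iA: "integrable M (\<lambda>\<omega>. ?X \<omega> * indicator ?A \<omega>)" by (rule iI) simp
    have iB: "integrable M (\<lambda>\<omega>. ?X \<omega> * indicator ?B \<omega>)" by (rule iI) simp
    have iD: "integrable M (\<lambda>\<omega>. ?K * indicator ?D \<omega>)"
      by (intro integrable_mult_right integrable_real_indicator) (auto simp: less_top[symmetric])
    have "exp (v n * (\<Lambda> \<theta> - \<zeta>)) < (\<integral>\<omega>. ?X \<omega> \<partial>M)"
    proof -
      have "v n * (\<Lambda> \<theta> - \<zeta>) < ln (\<integral>\<omega>. ?X \<omega> \<partial>M)" using elim(1) v0 by (simp add: field_simps)
      moreover have "0 < (\<integral>\<omega>. ?X \<omega> \<partial>M)"
        using iX by (rule expectation_greater) auto
      ultimately show ?thesis by (metis exp_less_cancel_iff exp_ln)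
    qed
    \<comment> \<open>Pointwise split: a point outside \<open>?A\<close> and \<open>?B\<close> has
      \<open>Z n\<close> in the ball, where the integrand is at most \<open>?K\<close>.\<close>
    also have "(\<integral>\<omega>. ?X \<omega> \<partial>M) \<le>
        (\<integral>\<omega>. ?X \<omega> * indicator ?A \<omega> + ?X \<omega> * indicator ?B \<omega> + ?K * indicator ?D \<omega> \<partial>M)"
    proof (rule integral_mono[OF iX])
      show "integrable M (\<lambda>\<omega>. ?X \<omega> * indicator ?A \<omega> + ?X \<omega> * indicator ?B \<omega> + ?K * indicator ?D \<omega>)"
        by (intro Bochner_Integration.integrable_add iA iB iD)
      fix \<omega> assume \<omega>: "\<omega> \<in> space M"
      show "?X \<omega> \<le> ?X \<omega> * indicator ?A \<omega> + ?X \<omega> * indicator ?B \<omega> + ?K * indicator ?D \<omega>"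
      proof (cases "\<omega> \<in> ?A \<or> \<omega> \<in> ?B")
        case True
        then show ?thesis by (auto simp: indicator_def)
      next
        case False
        have z: "\<bar>Z n \<omega> - x\<bar> < \<delta>" using False t by (auto simp: zero_le_mult_iff abs_if mult_le_0_iff not_le)
        then have "\<omega> \<in> ?D" using \<omega> by (auto simp: dist_real_def)
        moreover have "?X \<omega> \<le> ?K"
        proof -
          have "\<theta> * (Z n \<omega> - x) \<le> \<bar>\<theta>\<bar> * \<bar>Z n \<omega> - x\<bar>" by (metis abs_ge_self abs_mult)
          also have "\<dots> \<le> \<bar>\<theta>\<bar> * \<delta>" using z by (intro mult_left_mono) auto
          finally have "\<theta> * Z n \<omega> \<le> \<theta> * x + \<eta>" using \<delta>(2) by (simp add: algebra_simps)
          then have "(\<theta> * Z n \<omega>) * v n \<le> (\<theta> * x + \<eta>) * v n" using v0 by (intro mult_right_mono) auto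
          then show ?thesis by (simp add: mult_ac)
        qed
        ultimately show ?thesis by (simp add: indicator_def)
      qed
    qed
    also have "\<dots> = (\<integral>\<omega>. ?X \<omega> * indicator ?A \<omega> \<partial>M) + (\<integral>\<omega>. ?X \<omega> * indicator ?B \<omega> \<partial>M) + ?K * measure M ?D"
      using iA iB iD by (subst Bochner_Integration.integral_add, simp, simp)+ (simp add: Int_absorb2 subset_eq)
    also have "\<dots> \<le> 2 * exp (- \<kappa> * v n) + ?K * measure M ?D" using elim(3,4) by simp
    finally have 1: "exp (v n * (\<Lambda> \<theta> - \<zeta>)) < 2 * exp (- \<kappa> * v n) + ?K * measure M ?D" .
    have "4 * exp (- \<kappa> * v n) \<le> exp (v n * (\<Lambda> \<theta> - \<zeta>))"
    proof -
      have "ln 4 \<le> v n * (\<Lambda> \<theta> - \<zeta> + \<kappa>)" using elim(2) \<zeta>(3) by (simp add: field_simps)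
      then have "exp (ln 4 + - \<kappa> * v n) \<le> exp (v n * (\<Lambda> \<theta> - \<zeta>))" by (simp add: algebra_simps)
      then show ?thesis by (simp only: exp_add) simp
    qed
    with 1 have 2: "exp (v n * (\<Lambda> \<theta> - \<zeta>)) \<le> 2 * (?K * measure M ?D)" by simp
    have "ln 2 \<le> \<eta> * v n" using elim(2) \<eta> by (simp add: field_simps)
    moreover have "v n * \<zeta> \<le> v n * \<eta>" using v0 \<zeta>(2) by simp
    moreover have "- c * v n = (\<Lambda> \<theta> - 4 * \<eta> - \<theta> * x) * v n"
    proof -
      have "- c = \<Lambda> \<theta> - 4 * \<eta> - \<theta> * x" by (simp add: \<eta>_def field_simps)
      then show ?thesis by (rule arg_cong)
    qed
    ultimately have "ln 2 + (\<theta> * x + \<eta>) * v n + - c * v n \<le> v n * (\<Lambda> \<theta> - \<zeta>)"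
      using mult_pos_pos[OF \<eta> v0] by (simp add: algebra_simps)
    then have "exp (ln 2 + (\<theta> * x + \<eta>) * v n + - c * v n) \<le> exp (v n * (\<Lambda> \<theta> - \<zeta>))" by simp
    then have "2 * (?K * exp (- c * v n)) \<le> exp (v n * (\<Lambda> \<theta> - \<zeta>))"
      by (simp only: exp_add) simp
    also note 2
    finally have "exp (- c * v n) \<le> measure M ?D" by simp
    also have "\<dots> \<le> measure M {\<omega> \<in> space M. Z n \<omega> \<in> G}"
    proof (rule finite_measure_mono)
      show "?D \<subseteq> {\<omega> \<in> space M. Z n \<omega> \<in> G}" using \<delta>(3) by auto
      show "{\<omega> \<in> space M. Z n \<omega> \<in> G} \<in> sets M" using G(1) by (intro measurable_sets_Collect[OF meas[OF elim(5)]]) auto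
    qed
    finally show ?case .
  qed
qed

end

section \<open>Weighted averages of triangular arrays\<close>

text \<open>Cesaro argument: from some index on, \<open>g n j\<close> is a small fraction of
  \<open>a j\<close>; the finitely many earlier terms stay bounded while the denominator diverges.
  As \<open>g\<close> also depends on \<open>n\<close>, these need a bound \<open>b j\<close>
  uniform in \<open>n\<close>.\<close>

lemma weighted_average_tendsto_0:
  fixes a b :: "nat \<Rightarrow> real" and g :: "nat \<Rightarrow> nat \<Rightarrow> real"
  assumes a: "\<And>j. 1 \<le> j \<Longrightarrow> 0 \<le> a j"
    and L: "filterlim (\<lambda>n. \<Sum>j=1..n. a j) at_top sequentially"
    and b: "\<And>n j. 1 \<le> j \<Longrightarrow> j \<le> n \<Longrightarrow> \<bar>g n j\<bar> \<le> b j"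
    and small: "\<And>\<epsilon>. 0 < \<epsilon> \<Longrightarrow> \<forall>\<^sub>F j in sequentially. \<forall>n\<ge>j. \<bar>g n j\<bar> \<le> \<epsilon> * a j"
  shows "(\<lambda>n. (\<Sum>j=1..n. g n j) / (\<Sum>j=1..n. a j)) \<longlonglongrightarrow> 0"
proof (rule tendstoI)
  fix e :: real assume e: "0 < e"
  obtain J where J: "\<And>j n. J \<le> j \<Longrightarrow> j \<le> n \<Longrightarrow> \<bar>g n j\<bar> \<le> e / 2 * a j"
    using small[of "e / 2"] e unfolding eventually_sequentially by auto
  define B where "B = (\<Sum>j<J. \<bar>b j\<bar>)"
  have "\<forall>\<^sub>F n in sequentially. (\<Sum>j=1..n. a j) > max 0 (2 * B / e)"
    using L unfolding filterlim_at_top_dense by blast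
  then show "\<forall>\<^sub>F n in sequentially. dist ((\<Sum>j=1..n. g n j) / (\<Sum>j=1..n. a j)) 0 < e"
  proof eventually_elim
    case (elim n)
    have "\<bar>\<Sum>j=1..n. g n j\<bar> \<le> (\<Sum>j=1..n. \<bar>g n j\<bar>)" by (rule sum_abs)
    also have "\<dots> \<le> (\<Sum>j=1..n. (if j < J then \<bar>b j\<bar> else 0) + e / 2 * a j)"
    proof (rule sum_mono)
      fix j assume j: "j \<in> {1..n}"
      then have "0 \<le> e / 2 * a j" using a e by simp
      then show "\<bar>g n j\<bar> \<le> (if j < J then \<bar>b j\<bar> else 0) + e / 2 * a j"
        using J[of j n] b[of j n] j by (cases "j < J") auto
    qed
    also have "\<dots> = (\<Sum>j=1..n. if j < J then \<bar>b j\<bar> else 0) + e / 2 * (\<Sum>j=1..n. a j)"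
      by (simp add: sum.distrib sum_distrib_left)
    also have "(\<Sum>j=1..n. if j < J then \<bar>b j\<bar> else 0) = (\<Sum>j\<in>{1..n} \<inter> {..<J}. \<bar>b j\<bar>)"
      by (simp add: sum.inter_restrict)
    also have "\<dots> \<le> B" unfolding B_def by (rule sum_mono2) auto
    also have "B + e / 2 * (\<Sum>j=1..n. a j) < e * (\<Sum>j=1..n. a j)"
      using elim e by (simp add: field_simps)
    finally show ?case using elim by (simp add: dist_real_def field_simps)
  qed
qed

section \<open>The weights built from \<open>\<phi>\<close>\<close>

locale slowly_growing_concave =
  fixes \<phi> :: "nat \<Rightarrow> real"
  assumes strict_mono: "strict_mono \<phi>"
    and zero: "\<phi> 0 = 0"
    and ratio: "(\<lambda>n. \<phi> n / \<phi> (n + 1)) \<longlonglongrightarrow> 1"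
    and concave: "antimono_on {1..} (\<lambda>n. \<phi> n - \<phi> (n - 1))"
    and L_at_top: "filterlim (L_sum \<phi>) at_top sequentially"
begin

definition a :: "nat \<Rightarrow> real" where
  "a k = (\<phi> k - \<phi> (k - 1)) / \<phi> k"

definition w :: "nat \<Rightarrow> nat \<Rightarrow> real" where
  "w n j = \<phi> j * (\<Sum>k=j..n. a k / \<phi> k)"

lemma L_sum_eq: "L_sum \<phi> n = (\<Sum>k=1..n. a k)"
  by (simp add: L_sum_def a_def)

lemma phi_pos: "1 \<le> k \<Longrightarrow> 0 < \<phi> k"
  using strict_monoD[OF strict_mono, of 0 k] zero by simp

lemma phi_nonneg: "0 \<le> \<phi> k"
  using phi_pos[of k] zero by (cases k) auto

lemma a_pos: "1 \<le> k \<Longrightarrow> 0 < a k"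
  using phi_pos[of k] strict_monoD[OF strict_mono, of "k - 1" k] by (simp add: a_def)

lemma a_le_1: "1 \<le> k \<Longrightarrow> a k \<le> 1"
  using phi_pos[of k] phi_nonneg[of "k - 1"] by (simp add: a_def field_simps)

lemma L_sum_pos: "1 \<le> n \<Longrightarrow> 0 < L_sum \<phi> n"
  unfolding L_sum_eq by (rule sum_pos) (auto intro: a_pos)

lemma a_tendsto_0: "a \<longlonglongrightarrow> 0"
proof -
  have "(\<lambda>n. a (Suc n)) \<longlonglongrightarrow> 0"
  proof (rule Lim_transform_eventually)
    show "(\<lambda>n. 1 - \<phi> n / \<phi> (n + 1)) \<longlonglongrightarrow> 0" using tendsto_diff[OF tendsto_const ratio, of 1] by simp
    show "\<forall>\<^sub>F n in sequentially. 1 - \<phi> n / \<phi> (n + 1) = a (Suc n)"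
    proof (rule always_eventually, rule allI)
      fix n show "1 - \<phi> n / \<phi> (n + 1) = a (Suc n)"
        using phi_pos[of "Suc n"] by (simp add: a_def field_simps)
    qed
  qed
  then show ?thesis by (rule filterlim_sequentially_Suc[THEN iffD1])
qed

lemma w_pos: "1 \<le> j \<Longrightarrow> j \<le> n \<Longrightarrow> 0 < w n j"
  unfolding w_def by (intro mult_pos_pos sum_pos divide_pos_pos) (auto intro: phi_pos a_pos)

text \<open>For \<open>k > j\<close>, lowering one factor \<open>\<phi> k\<close> of the denominator
  to \<open>\<phi> (k - 1)\<close> gives
  \<open>a k / \<phi> k \<le> 1 / \<phi> (k - 1) - 1 / \<phi> k\<close>, which telescopes. The term
  \<open>k = j\<close> is kept apart, since for \<open>j = 1\<close> this would divide by
  \<open>\<phi> 0 = 0\<close>.\<close>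

lemma w_le:
  assumes "1 \<le> j" "j \<le> n"
  shows "w n j \<le> 1 + a j"
proof -
  have "(\<Sum>k=j..n. a k / \<phi> k) \<le> a j / \<phi> j + (1 / \<phi> j - 1 / \<phi> n)"
    using assms(2)
  proof (induction n rule: dec_induct)
    case base
    then show ?case by simp
  next
    case (step n)
    have p: "0 < \<phi> n" "0 < \<phi> (Suc n)" "\<phi> n \<le> \<phi> (Suc n)"
      using phi_pos[of n] phi_pos[of "Suc n"] step(1) assms(1) strict_monoD[OF strict_mono, of n "Suc n"] by auto
    have "a (Suc n) / \<phi> (Suc n) = (\<phi> (Suc n) - \<phi> n) / (\<phi> (Suc n) * \<phi> (Suc n))" by (simp add: a_def)
    also have "\<dots> \<le> (\<phi> (Suc n) - \<phi> n) / (\<phi> n * \<phi> (Suc n))"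
      using p by (intro divide_left_mono mult_right_mono mult_pos_pos) auto
    also have "\<dots> = 1 / \<phi> n - 1 / \<phi> (Suc n)" using p by (simp add: field_simps)
    finally show ?case using step by simp
  qed
  moreover have "0 < \<phi> j" "0 < \<phi> n" using assms phi_pos by auto
  ultimately have "w n j \<le> \<phi> j * (a j / \<phi> j + (1 / \<phi> j - 1 / \<phi> n))"
    unfolding w_def by (intro mult_left_mono) auto
  also have "\<dots> = a j + 1 - \<phi> j / \<phi> n" using \<open>0 < \<phi> j\<close> \<open>0 < \<phi> n\<close> by (simp add: field_simps)
  also have "\<dots> \<le> 1 + a j" using \<open>0 < \<phi> j\<close> \<open>0 < \<phi> n\<close> by simp
  finally show ?thesis .
qed

text \<open>The increment at \<open>k\<close> is at least the next one, so each term dominates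
  \<open>1 / \<phi> k - 1 / \<phi> (k + 1)\<close>. This shift by one is why the telescoped bound
  ends at \<open>n + 1\<close>.\<close>

lemma w_ge:
  assumes "1 \<le> j" "j \<le> n"
  shows "1 - \<phi> j / \<phi> (n + 1) \<le> w n j"
proof -
  have step: "1 / \<phi> k - 1 / \<phi> (Suc k) \<le> a k / \<phi> k" if k: "1 \<le> k" for k
  proof -
    have p: "0 < \<phi> k" "0 < \<phi> (Suc k)" "\<phi> k \<le> \<phi> (Suc k)" "\<phi> (k - 1) \<le> \<phi> k"
      using phi_pos[of k] phi_pos[of "Suc k"] k strict_mono_less_eq[OF strict_mono] by auto
    have c: "\<phi> (Suc k) - \<phi> k \<le> \<phi> k - \<phi> (k - 1)"
      using monotone_onD[OF concave, of k "Suc k"] k by simp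
    have "1 / \<phi> k - 1 / \<phi> (Suc k) = (\<phi> (Suc k) - \<phi> k) / (\<phi> k * \<phi> (Suc k))"
      using p by (simp add: field_simps)
    also have "\<dots> \<le> (\<phi> k - \<phi> (k - 1)) / (\<phi> k * \<phi> k)"
      using p c by (intro frac_le mult_left_mono mult_pos_pos) auto
    also have "\<dots> = a k / \<phi> k" by (simp add: a_def)
    finally show ?thesis .
  qed
  have "1 / \<phi> j - 1 / \<phi> (n + 1) \<le> (\<Sum>k=j..n. a k / \<phi> k)"
    using assms(2)
  proof (induction n rule: dec_induct)
    case base
    then show ?case using step[of j] assms(1) by simp
  next
    case (step n)
    then show ?case using \<open>\<And>k. 1 \<le> k \<Longrightarrow> _\<close>[of "Suc n"] by simp
  qed
  moreover have "0 < \<phi> j" "0 < \<phi> (n + 1)" using assms phi_pos by auto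
  ultimately have "\<phi> j * (1 / \<phi> j - 1 / \<phi> (n + 1)) \<le> w n j"
    unfolding w_def by (intro mult_left_mono) auto
  moreover have "\<phi> j * (1 / \<phi> j - 1 / \<phi> (n + 1)) = 1 - \<phi> j / \<phi> (n + 1)"
    using \<open>0 < \<phi> j\<close> by (simp add: right_diff_distrib)
  ultimately show ?thesis by simp
qed

lemma w_bounds:
  assumes "1 \<le> j" "j \<le> n"
  shows "\<bar>w n j\<bar> \<le> 2" "\<bar>w n j - 1\<bar> \<le> a j + \<phi> j / \<phi> (n + 1)"
proof -
  have "0 \<le> \<phi> j / \<phi> (n + 1)" using phi_nonneg by simp
  then show "\<bar>w n j\<bar> \<le> 2" "\<bar>w n j - 1\<bar> \<le> a j + \<phi> j / \<phi> (n + 1)"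
    using w_pos[OF assms] w_le[OF assms] w_ge[OF assms] a_le_1[OF assms(1)] a_pos[OF assms(1)] by linarith+
qed

lemma L_sum_Z_seq:
  assumes "1 \<le> n"
  shows "L_sum \<phi> n * Z_seq \<phi> R n \<omega> = (\<Sum>j=1..n. w n j * real (R j \<omega>))"
proof -
  have "L_sum \<phi> n * Z_seq \<phi> R n \<omega> = (\<Sum>k=1..n. a k * W_seq \<phi> R k \<omega>)"
    using L_sum_pos[OF assms] by (simp add: Z_seq_def a_def)
  also have "\<dots> = (\<Sum>k=1..n. \<Sum>j=1..k. a k / \<phi> k * \<phi> j * real (R j \<omega>))"
    by (simp add: W_seq_def sum_distrib_left mult.assoc)
  also have "\<dots> = (\<Sum>j=1..n. \<Sum>k=j..n. a k / \<phi> k * \<phi> j * real (R j \<omega>))"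
    by (subst sum.Sigma, simp, simp, subst sum.Sigma, simp, simp)
       (rule sum.reindex_bij_witness[of _ prod.swap prod.swap], auto)
  also have "\<dots> = (\<Sum>j=1..n. w n j * real (R j \<omega>))"
    by (simp add: w_def sum_distrib_left sum_distrib_right mult_ac)
  finally show ?thesis .
qed

text \<open>The error \<open>\<phi> j / \<phi> (n + 1)\<close> of \<open>w n j\<close> need not be
  small for \<open>j\<close> near \<open>n\<close>. Weighted by \<open>a j\<close> it nevertheless
  sums to at most 1, and the other error contributes a sum of \<open>a j * a j\<close>; both are
  negligible against \<open>L_sum \<phi> n\<close>.\<close>

lemma weighted_average_w_tendsto:
  assumes lip: "\<And>x. 0 \<le> x \<Longrightarrow> x \<le> 2 \<Longrightarrow> \<bar>h x - h 1\<bar> \<le> K * \<bar>x - 1\<bar>"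
  shows "(\<lambda>n. (\<Sum>j=1..n. a j * h (w n j)) / L_sum \<phi> n) \<longlonglongrightarrow> h 1"
proof -
  have K: "0 \<le> K" using lip[of 0] by simp
  have "(\<lambda>n. (\<Sum>j=1..n. a j * a j) / (\<Sum>j=1..n. a j)) \<longlonglongrightarrow> 0"
  proof (rule weighted_average_tendsto_0[where g = "\<lambda>n j. a j * a j" and b = "\<lambda>j. a j * a j"])
    show "\<forall>\<^sub>F j in sequentially. \<forall>n\<ge>j. \<bar>a j * a j\<bar> \<le> \<epsilon> * a j" if "0 < \<epsilon>" for \<epsilon>
      using order_tendstoD(2)[OF a_tendsto_0 that] eventually_ge_at_top[of 1]
      by eventually_elim (use a_pos in \<open>auto intro!: mult_right_mono less_imp_le\<close>)
  qed (use a_pos L_at_top in \<open>auto simp: less_imp_le L_sum_eq[abs_def]\<close>)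
  then have 1: "(\<lambda>n. (\<Sum>j=1..n. a j * a j) / L_sum \<phi> n) \<longlonglongrightarrow> 0" by (simp only: L_sum_eq)
  have 2: "(\<lambda>n. 1 / L_sum \<phi> n) \<longlonglongrightarrow> 0"
    using L_at_top by (intro real_tendsto_divide_at_top) auto
  have "(\<lambda>n. K * ((\<Sum>j=1..n. a j * a j) / L_sum \<phi> n + 1 / L_sum \<phi> n)) \<longlonglongrightarrow> K * (0 + 0)"
    by (intro tendsto_intros 1 2)
  then have 3: "(\<lambda>n. K * ((\<Sum>j=1..n. a j * a j) / L_sum \<phi> n + 1 / L_sum \<phi> n)) \<longlonglongrightarrow> 0" by simp
  have "(\<lambda>n. (\<Sum>j=1..n. a j * h (w n j)) / L_sum \<phi> n - h 1) \<longlonglongrightarrow> 0"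
  proof (rule Lim_null_comparison[OF _ 3])
    show "\<forall>\<^sub>F n in sequentially. norm ((\<Sum>j=1..n. a j * h (w n j)) / L_sum \<phi> n - h 1)
       \<le> K * ((\<Sum>j=1..n. a j * a j) / L_sum \<phi> n + 1 / L_sum \<phi> n)"
      using eventually_ge_at_top[of 1]
    proof eventually_elim
      case (elim n)
      let ?L = "L_sum \<phi> n"
      have L: "0 < ?L" using elim by (rule L_sum_pos)
      have "\<bar>(\<Sum>j=1..n. a j * h (w n j)) - h 1 * ?L\<bar> = \<bar>\<Sum>j=1..n. a j * (h (w n j) - h 1)\<bar>"
        by (simp add: L_sum_eq right_diff_distrib sum_subtractf sum_distrib_left mult.commute)
      also have "\<dots> \<le> (\<Sum>j=1..n. \<bar>a j * (h (w n j) - h 1)\<bar>)" by (rule sum_abs)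
      also have "\<dots> \<le> (\<Sum>j=1..n. K * (a j * a j) + K * ((\<phi> j - \<phi> (j - 1)) / \<phi> (n + 1)))"
      proof (rule sum_mono)
        fix j assume "j \<in> {1..n}"
        then have j: "1 \<le> j" "j \<le> n" by auto
        have "\<bar>a j * (h (w n j) - h 1)\<bar> = a j * \<bar>h (w n j) - h 1\<bar>"
          using a_pos[OF j(1)] by (simp add: abs_mult)
        also have "\<dots> \<le> a j * (K * \<bar>w n j - 1\<bar>)"
          using a_pos[OF j(1)] w_pos[OF j] w_bounds(1)[OF j] by (intro mult_left_mono lip) auto
        also have "\<dots> \<le> a j * (K * (a j + \<phi> j / \<phi> (n + 1)))"
          using a_pos[OF j(1)] K w_bounds(2)[OF j] by (intro mult_left_mono) auto
        \<comment> \<open>The weight cancels the numerator: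
          \<open>a j * \<phi> j = \<phi> j - \<phi> (j - 1)\<close>, ready to telescope.\<close>
        also have "\<dots> = K * (a j * a j) + K * ((\<phi> j - \<phi> (j - 1)) / \<phi> (n + 1))"
          using phi_pos[OF j(1)] phi_pos[of "n + 1"] by (simp add: a_def field_simps)
        finally show "\<bar>a j * (h (w n j) - h 1)\<bar> \<le> \<dots>" .
      qed
      also have "\<dots> = K * (\<Sum>j=1..n. a j * a j) + K * ((\<Sum>j=1..n. \<phi> j - \<phi> (j - 1)) / \<phi> (n + 1))"
        by (simp add: sum.distrib sum_distrib_left sum_divide_distrib)
      also have "(\<Sum>j=1..n. \<phi> j - \<phi> (j - 1)) = \<phi> n"
        using zero by (induction n) auto
      also have "K * (\<phi> n / \<phi> (n + 1)) \<le> K * 1"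
        using K phi_pos[of "n + 1"] strict_mono_less_eq[OF strict_mono, of n "n + 1"]
        by (intro mult_left_mono) auto
      finally have "\<bar>(\<Sum>j=1..n. a j * h (w n j)) - h 1 * ?L\<bar> \<le> K * (\<Sum>j=1..n. a j * a j) + K" by simp
      then have "\<bar>(\<Sum>j=1..n. a j * h (w n j)) - h 1 * ?L\<bar> / ?L \<le> (K * (\<Sum>j=1..n. a j * a j) + K) / ?L"
        using L by (intro divide_right_mono) auto
      moreover have "(\<Sum>j=1..n. a j * h (w n j)) / ?L - h 1 = ((\<Sum>j=1..n. a j * h (w n j)) - h 1 * ?L) / ?L"
        using L by (simp add: diff_divide_distrib)
      ultimately show ?case using L by (simp add: abs_divide add_divide_distrib distrib_left)
    qed
  qed
  then show ?thesis by (simp add: LIM_zero_iff)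
qed

text \<open>Since \<open>pi_seq \<phi> \<nu> k = (1 - a k) powr \<nu>\<close>, this is the
  first-order expansion at 0 along \<open>a k\<close>, which tends to 0 from the right.\<close>

lemma one_minus_pi_seq_asymp: "(\<lambda>k. (1 - pi_seq \<phi> \<nu> k) / a k) \<longlonglongrightarrow> \<nu>"
proof -
  have "((\<lambda>x. (1 - (1 - x) powr \<nu>) / x) \<longlongrightarrow> \<nu>) (at_right 0)"
    by real_asymp
  moreover have "filterlim a (at_right 0) sequentially"
  proof (rule tendsto_imp_filterlim_at_right[OF a_tendsto_0])
    show "\<forall>\<^sub>F k in sequentially. 0 < a k"
      using eventually_ge_at_top[of 1] by eventually_elim (rule a_pos)
  qed
  ultimately have "(\<lambda>k. (1 - (1 - a k) powr \<nu>) / a k) \<longlonglongrightarrow> \<nu>"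
    by (rule filterlim_compose)
  then show ?thesis
  proof (rule Lim_transform_eventually)
    show "\<forall>\<^sub>F k in sequentially. (1 - (1 - a k) powr \<nu>) / a k = (1 - pi_seq \<phi> \<nu> k) / a k"
      using eventually_ge_at_top[of 1]
    proof eventually_elim
      case (elim k)
      have "1 - a k = \<phi> (k - 1) / \<phi> k" using phi_pos[OF elim] by (simp add: a_def field_simps)
      then show ?case by (simp add: pi_seq_def)
    qed
  qed
qed

end

section \<open>The Poisson rate function and its duality\<close>

lemma poisson_rate_altdef: "0 \<le> x \<Longrightarrow> poisson_rate \<nu> x = ereal (x * ln (x / \<nu>) - x + \<nu>)"
  by (simp add: poisson_rate_def)

text \<open>Only the point 0 needs an argument: \<open>x * ln x\<close> tends to 0 there, matching
  the value 0 of the product at 0.\<close>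

lemma continuous_on_poisson_rate:
  fixes \<nu> :: real assumes "0 < \<nu>"
  shows "continuous_on {0..} (\<lambda>x. x * ln (x / \<nu>) - x + \<nu>)"
proof -
  have "((\<lambda>x. x * ln (x / \<nu>) - x + \<nu>) \<longlongrightarrow> x * ln (x / \<nu>) - x + \<nu>) (at x within {0..})" if "0 \<le> x" for x
  proof (cases "x = 0")
    case True
    have "((\<lambda>x. x * ln (x / \<nu>) - x + \<nu>) \<longlongrightarrow> \<nu>) (at_right 0)"
      using assms by real_asymp
    then show ?thesis using True by (simp add: at_within_Ici_at_right)
  next
    case False
    then show ?thesis using that assms by (intro tendsto_intros) auto
  qed
  then show ?thesis by (simp add: continuous_on_def)
qed

text \<open>The inequality \<open>ln y \<le> y - 1\<close> at \<open>y = \<nu> / x\<close>,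
  multiplied by \<open>- x\<close>.\<close>

lemma poisson_rate_nonneg:
  assumes "0 < \<nu>" shows "0 \<le> poisson_rate \<nu> x"
proof (cases "0 < x")
  case True
  have "x * (1 - \<nu> / x) \<le> x * ln (x / \<nu>)"
    using ln_le_minus_one[of "\<nu> / x"] True assms by (intro mult_left_mono) (auto simp: ln_div)
  then show ?thesis using True by (simp add: poisson_rate_def algebra_simps)
qed (use assms in \<open>auto simp: poisson_rate_def\<close>)

text \<open>The rate is infinite on the negative axis, so negative points never violate the bound
  and continuity within \<open>{0..}\<close> decides.\<close>

lemma lower_semicontinuous_poisson_rate:
  assumes \<nu>: "0 < \<nu>" shows "lower_semicontinuous (poisson_rate \<nu>)"
  unfolding lower_semicontinuous_def le_Liminf_iff
proof (intro allI impI)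
  fix x y assume y: "y < poisson_rate \<nu> x"
  let ?h = "\<lambda>x. x * ln (x / \<nu>) - x + \<nu>"
  have neg: "y < poisson_rate \<nu> z" if "z < 0" for z
    using that y by (auto simp: poisson_rate_def less_le)
  show "\<forall>\<^sub>F z in at x. y < poisson_rate \<nu> z"
  proof (cases "x < 0")
    case True
    have "\<forall>\<^sub>F z in at x. z < 0" using True by (intro order_tendstoD(2)[OF tendsto_ident_at])
    then show ?thesis by eventually_elim (rule neg)
  next
    case False
    have "((\<lambda>z. ereal (?h z)) \<longlongrightarrow> ereal (?h x)) (at x within {0..})"
      using continuous_on_poisson_rate[OF \<nu>] False by (auto simp: continuous_on_def)
    moreover have "y < ereal (?h x)" using y False by (simp add: poisson_rate_altdef)
    ultimately have "\<forall>\<^sub>F z in at x within {0..}. y < ereal (?h z)" by (rule order_tendstoD)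
    then show ?thesis unfolding eventually_at_filter
    proof eventually_elim
      case (elim z)
      then show ?case using neg[of z] by (cases "z < 0") (auto simp: poisson_rate_altdef)
    qed
  qed
qed

lemma good_rate_function_poisson_rate:
  assumes \<nu>: "0 < \<nu>" shows "good_rate_function (poisson_rate \<nu>)"
  unfolding good_rate_function_def
proof (intro allI impI)
  fix \<eta> :: real assume \<eta>: "0 \<le> \<eta>"
  let ?h = "\<lambda>x. x * ln (x / \<nu>) - x + \<nu>"
  have eq: "{z. poisson_rate \<nu> z \<le> ereal \<eta>} = {z\<in>{0..}. ?h z \<le> \<eta>}"
    by (auto simp: poisson_rate_def split: if_splits)
  have "closed {z\<in>{0..}. ?h z \<le> \<eta>}"
    by (intro continuous_on_closed_Collect_le continuous_on_poisson_rate[OF \<nu>] continuous_on_const closed_atLeast)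
  \<comment> \<open>Beyond \<open>\<nu> * exp 2\<close> the logarithm is at least 2, hence
    \<open>?h z \<ge> z + \<nu>\<close>, and \<open>?h z \<le> \<eta>\<close> forces
    \<open>z \<le> \<eta>\<close>.\<close>
  moreover have "{z\<in>{0..}. ?h z \<le> \<eta>} \<subseteq> {0..max (\<nu> * exp 2) \<eta>}"
  proof
    fix z assume z: "z \<in> {z\<in>{0..}. ?h z \<le> \<eta>}"
    show "z \<in> {0..max (\<nu> * exp 2) \<eta>}"
    proof (cases "z \<le> \<nu> * exp 2")
      case False
      then have "exp 2 < z / \<nu>" using \<nu> by (simp add: field_simps)
      moreover from this have "0 < z / \<nu>" by (meson exp_gt_zero less_trans)
      ultimately have "2 \<le> ln (z / \<nu>)" by (simp add: ln_ge_iff)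
      then have "z * 2 \<le> z * ln (z / \<nu>)" using z by (intro mult_left_mono) auto
      then show ?thesis using z \<nu> by auto
    qed (use z in auto)
  qed
  ultimately show "compact {z. poisson_rate \<nu> z \<le> ereal \<eta>}"
    unfolding eq compact_eq_bounded_closed by (meson bounded_closed_interval bounded_subset)
qed

text \<open>The optimal \<open>\<theta> = ln (x / \<nu>)\<close> does not exist for \<open>x = 0\<close>, hence the strict inequality.\<close>

lemma poisson_rate_legendre:
  fixes \<nu> :: real
  assumes \<nu>: "0 < \<nu>" and x: "0 \<le> x" and c: "ereal c < poisson_rate \<nu> x"
  obtains \<theta> where "c < \<theta> * x - \<nu> * (exp \<theta> - 1)" "\<nu> \<le> x \<Longrightarrow> 0 \<le> \<theta>" "x \<le> \<nu> \<Longrightarrow> \<theta> \<le> 0"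
proof (cases "x = 0")
  case True
  have "c < \<nu>" using c True by (simp add: poisson_rate_def)
  \<comment> \<open>\<open>s\<close> plays the role of \<open>exp \<theta>\<close>. At
    \<open>x = 0\<close> the objective is \<open>\<nu> * (1 - s)\<close>, which exceeds
    \<open>c\<close> once \<open>\<nu> * s < \<nu> - c\<close>; the cap \<open>1 / 2\<close> keeps
    \<open>\<theta>\<close> negative.\<close>
  define s where "s = min (1 / 2) ((\<nu> - c) / (2 * \<nu>))"
  have s: "0 < s" "s < 1" "\<nu> * s < \<nu> - c"
  proof -
    show "0 < s" "s < 1" using \<open>c < \<nu>\<close> \<nu> by (auto simp: s_def)
    have "\<nu> * s \<le> \<nu> * ((\<nu> - c) / (2 * \<nu>))" using \<nu> by (intro mult_left_mono) (auto simp: s_def)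
    also have "\<dots> < \<nu> - c" using \<open>c < \<nu>\<close> \<nu> by (simp add: field_simps)
    finally show "\<nu> * s < \<nu> - c" .
  qed
  show ?thesis
    by (rule that[of "ln s"]) (use s True \<nu> in \<open>auto simp: algebra_simps\<close>)
next
  case False
  show ?thesis
    by (rule that[of "ln (x / \<nu>)"])
       (use c x False \<nu> in \<open>auto simp: poisson_rate_def algebra_simps\<close>)
qed

section \<open>Large deviation principle from the limiting cumulant function\<close>

text \<open>Gaertner-Ellis for the limit \<open>\<nu> * (exp \<theta> - 1)\<close>, whose Legendre
  transform is the Poisson rate. A closed set is split at the minimiser \<open>\<nu>\<close>, and
  each part lies in a half-line starting at its point nearest to \<open>\<nu>\<close>.\<close>

lemma (in prob_space) LDP_poisson_rate:
  fixes Z :: "nat \<Rightarrow> 'a \<Rightarrow> real" and v :: "nat \<Rightarrow> real"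
  assumes \<nu>: "0 < \<nu>"
    and meas: "\<And>n. 1 \<le> n \<Longrightarrow> Z n \<in> borel_measurable M"
    and nonneg: "\<And>n \<omega>. 1 \<le> n \<Longrightarrow> 0 \<le> Z n \<omega>"
    and int: "\<And>n s. 1 \<le> n \<Longrightarrow> integrable M (\<lambda>\<omega>. exp (s * Z n \<omega>))"
    and v: "filterlim v at_top sequentially"
    and lim: "\<And>\<theta>. (\<lambda>n. ln (\<integral>\<omega>. exp (\<theta> * v n * Z n \<omega>) \<partial>M) / v n) \<longlonglongrightarrow> \<nu> * (exp \<theta> - 1)"
  shows "satisfies_LDP M Z v (poisson_rate \<nu>)"
proof -
  let ?P = "\<lambda>n S. measure M {\<omega> \<in> space M. Z n \<omega> \<in> S}"
  \<comment> \<open>\<open>S\<close> lies on the side of \<open>x\<close> away from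
    \<open>\<nu>\<close>. The sign of \<open>t\<close> supplied by the duality lemma places
    \<open>S\<close> inside the event of the Chernoff bound.\<close>
  have half_line: "\<forall>\<^sub>F n in sequentially. ?P n S \<le> exp (- c * v n)"
    if x: "0 \<le> x" "ereal c < poisson_rate \<nu> x"
      and S: "\<And>z. z \<in> S \<Longrightarrow> \<nu> \<le> x \<and> x \<le> z \<or> x \<le> \<nu> \<and> z \<le> x" for S x c
  proof -
    obtain t where t: "c < t * x - \<nu> * (exp t - 1)" "\<nu> \<le> x \<Longrightarrow> 0 \<le> t" "x \<le> \<nu> \<Longrightarrow> t \<le> 0"
      using poisson_rate_legendre[OF \<nu> x] by blast
    have lim': "(\<lambda>n. ln (\<integral>\<omega>. exp ((0 + t) * v n * Z n \<omega>) \<partial>M) / v n) \<longlonglongrightarrow> \<nu> * (exp t - 1)"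
      using lim[of t] by simp
    have "\<forall>\<^sub>F n in sequentially. (\<integral>\<omega>. exp (0 * v n * Z n \<omega>) * indicator {\<omega>. 0 \<le> t * (Z n \<omega> - x)} \<omega> \<partial>M)
      \<le> exp (- c * v n)"
      using meas int by (rule eventually_tilted_tail_le[OF _ _ v lim' t(1)])
    then show ?thesis using eventually_ge_at_top[of 1]
    proof eventually_elim
      case (elim n)
      note [measurable] = meas[OF elim(2)]
      have "?P n S \<le> measure M {\<omega> \<in> space M. 0 \<le> t * (Z n \<omega> - x)}"
      proof (rule finite_measure_mono)
        show "{\<omega> \<in> space M. Z n \<omega> \<in> S} \<subseteq> {\<omega> \<in> space M. 0 \<le> t * (Z n \<omega> - x)}"
          using S t(2,3) by (fastforce simp: zero_le_mult_iff)
      qed measurable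
      also have "\<dots> = (\<integral>\<omega>. indicator {\<omega> \<in> space M. 0 \<le> t * (Z n \<omega> - x)} \<omega> \<partial>M)"
        by (simp add: Int_absorb2 subset_eq)
      also have "\<dots> = (\<integral>\<omega>. exp (0 * v n * Z n \<omega>) * indicator {\<omega>. 0 \<le> t * (Z n \<omega> - x)} \<omega> \<partial>M)"
        by (intro Bochner_Integration.integral_cong) (auto simp: indicator_def)
      finally show ?case using elim(1) by linarith
    qed
  qed
  show ?thesis unfolding satisfies_LDP_def
  proof (intro conjI allI impI)
    show "Z n \<in> borel_measurable M" if "1 \<le> n" for n by (rule meas[OF that])
    show "filterlim v at_top sequentially" by (rule v)
    show "0 \<le> poisson_rate \<nu> x" for x by (rule poisson_rate_nonneg[OF \<nu>])
    show "lower_semicontinuous (poisson_rate \<nu>)" by (rule lower_semicontinuous_poisson_rate[OF \<nu>])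
  next
    fix F :: "real set" assume F: "closed F"
    show "limsup (\<lambda>n. ereal (1 / v n) * ln_prob (?P n F)) \<le> - (INF z\<in>F. poisson_rate \<nu> z)"
    proof (rule limsup_ln_prob_le[OF v])
      fix c assume c: "ereal c < (INF z\<in>F. poisson_rate \<nu> z)"
      then have cF: "ereal c < poisson_rate \<nu> z" if "z \<in> F" for z
        using that by (meson INF_lower less_le_trans)
      have up: "\<forall>\<^sub>F n in sequentially. ?P n (F \<inter> {\<nu>..}) \<le> exp (- c * v n)"
      proof (cases "F \<inter> {\<nu>..} = {}")
        case False
        have "Inf (F \<inter> {\<nu>..}) \<in> F \<inter> {\<nu>..}"
          using False F by (intro closed_contains_Inf closed_Int) auto
        then show ?thesis using \<nu> cF
          by (intro half_line[of "Inf (F \<inter> {\<nu>..})"]) (auto intro!: cInf_lower bdd_belowI[of _ \<nu>])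
      qed simp
      \<comment> \<open>Cutting at 0 loses nothing because \<open>Z n\<close> is nonnegative, and it
        keeps the supremum in the domain where the rate is finite.\<close>
      have down: "\<forall>\<^sub>F n in sequentially. ?P n (F \<inter> {0..\<nu>}) \<le> exp (- c * v n)"
      proof (cases "F \<inter> {0..\<nu>} = {}")
        case False
        have "Sup (F \<inter> {0..\<nu>}) \<in> F \<inter> {0..\<nu>}"
          using False F by (intro closed_contains_Sup closed_Int) auto
        then show ?thesis using \<nu> cF
          by (intro half_line[of "Sup (F \<inter> {0..\<nu>})"]) (auto intro!: cSup_upper bdd_aboveI[of _ \<nu>])
      qed simp
      have "\<forall>\<^sub>F n in sequentially. ?P n F \<le> 2 * exp (- c * v n)"
        using up down eventually_ge_at_top[of 1]
      proof eventually_elim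
        case (elim n)
        have sets: "{\<omega> \<in> space M. Z n \<omega> \<in> S} \<in> events" if "closed S" for S
          using that by (intro measurable_sets_Collect[OF meas[OF elim(3)]]) auto
        have "?P n F \<le> measure M ({\<omega> \<in> space M. Z n \<omega> \<in> F \<inter> {\<nu>..}} \<union> {\<omega> \<in> space M. Z n \<omega> \<in> F \<inter> {0..\<nu>}})"
          using nonneg[OF elim(3)] F by (intro finite_measure_mono sets.Un sets closed_Int) auto
        also have "\<dots> \<le> ?P n (F \<inter> {\<nu>..}) + ?P n (F \<inter> {0..\<nu>})"
          using F by (intro measure_Un_le sets closed_Int) auto
        finally show ?case using elim(1,2) by linarith
      qed
      then show "\<exists>K. \<forall>\<^sub>F n in sequentially. ?P n F \<le> K * exp (- c * v n)" by blast
    qed simp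
  next
    fix G :: "real set" assume G: "open G"
    show "- (INF z\<in>G. poisson_rate \<nu> z) \<le> liminf (\<lambda>n. ereal (1 / v n) * ln_prob (?P n G))"
    proof (rule liminf_ln_prob_ge[OF v])
      fix c assume "(INF z\<in>G. poisson_rate \<nu> z) < ereal c"
      then obtain y where y: "y \<in> G" "poisson_rate \<nu> y < ereal c" by (auto simp: INF_less_iff)
      let ?h = "\<lambda>x. x * ln (x / \<nu>) - x + \<nu>"
      have y0: "0 \<le> y" "?h y < c" using y(2) by (auto simp: poisson_rate_def split: if_splits)
      \<comment> \<open>The near-minimiser \<open>y\<close> may be 0, where no optimal tilt exists.
        Right continuity allows moving to some \<open>x > y\<close> in \<open>G\<close>, which is
        positive.\<close>
      have "(?h \<longlongrightarrow> ?h y) (at_right y)"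
        using continuous_on_poisson_rate[OF \<nu>] y0(1) unfolding continuous_on_def
        by (auto intro: tendsto_within_subset)
      then have "\<forall>\<^sub>F x in at_right y. ?h x < c" using y0(2) by (rule order_tendstoD)
      moreover have "\<forall>\<^sub>F x in at_right y. x \<in> G"
        using G y(1) by (intro topological_tendstoD[OF tendsto_ident_at])
      moreover have "\<forall>\<^sub>F x in at_right y. y < x" by (simp add: eventually_at_filter)
      ultimately have "\<forall>\<^sub>F x in at_right y. ?h x < c \<and> x \<in> G \<and> y < x" by eventually_elim simp
      then obtain x where x: "?h x < c" "x \<in> G" "y < x"
        using eventually_happens'[of "at_right y"] trivial_limit_at_right_real by blast
      have x0: "0 < x" using x y0 by simp
      \<comment> \<open>The tilt \<open>ln (x / \<nu>)\<close> makes \<open>x\<close> the derivative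
        of the limit, and the Legendre expression there equals \<open>?h x\<close>.\<close>
      have "((\<lambda>\<theta>. \<nu> * (exp \<theta> - 1)) has_real_derivative x) (at (ln (x / \<nu>)))"
        using x0 \<nu> by (auto intro!: derivative_eq_intros)
      moreover have "ln (x / \<nu>) * x - \<nu> * (exp (ln (x / \<nu>)) - 1) < c"
        using x(1) x0 \<nu> by (simp add: algebra_simps)
      ultimately show "\<forall>\<^sub>F n in sequentially. exp (- c * v n) \<le> ?P n G"
        using meas int by (intro eventually_prob_ge[OF _ _ v lim _ G x(2)])
    qed
  qed
qed

section \<open>Logarithmic moment generating function of a single variable\<close>

text \<open>Values of \<open>X\<close> above 1 contribute nonnegatively. This bounds the excess from
  below at each \<open>\<tau>\<close> separately, not merely its supremum.\<close>

lemma (in prob_space) mgf_nat_lower_bound: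
  fixes X :: "'a \<Rightarrow> nat"
  assumes [measurable]: "X \<in> measurable M (count_space UNIV)"
    and int: "integrable M (\<lambda>\<omega>. exp (\<tau> * real (X \<omega>)))"
  shows "prob {\<omega> \<in> space M. X \<omega> = 0} + exp \<tau> * prob {\<omega> \<in> space M. X \<omega> = 1} \<le> (\<integral>\<omega>. exp (\<tau> * real (X \<omega>)) \<partial>M)"
proof -
  let ?A = "\<lambda>j. {\<omega> \<in> space M. X \<omega> = j}"
  have i: "integrable M (indicator (?A j) :: 'a \<Rightarrow> real)" for j
    by (intro integrable_real_indicator) (auto simp: less_top[symmetric])
  have "prob (?A 0) + exp \<tau> * prob (?A 1) = (\<integral>\<omega>. indicator (?A 0) \<omega> + exp \<tau> * indicator (?A 1) \<omega> \<partial>M)"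
    using i by (subst Bochner_Integration.integral_add) (auto simp: Int_absorb2 subset_eq)
  also have "\<dots> \<le> (\<integral>\<omega>. exp (\<tau> * real (X \<omega>)) \<partial>M)"
    by (intro integral_mono Bochner_Integration.integrable_add integrable_mult_right i int) (auto simp: indicator_def)
  finally show ?thesis .
qed

text \<open>
  Here \<open>p k = 1 - P(R k = 0)\<close>, \<open>u k = 1 - \<pi> k\<close> and \<open>E\<close> stands for \<open>E[exp (\<tau> R k)]\<close>; then
  \<open>(1 - p k) * u k = P(R k = 1)\<close>.
\<close>

lemma log_mgf_approx:
  fixes a u p :: "nat \<Rightarrow> real" and \<nu> T C \<epsilon> :: real
  assumes a: "\<And>k. 1 \<le> k \<Longrightarrow> 0 < a k" "a \<longlonglongrightarrow> 0"
    and u: "(\<lambda>k. u k / a k) \<longlonglongrightarrow> \<nu>" "0 < \<nu>"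
    and p: "(\<lambda>k. p k / u k) \<longlonglongrightarrow> 1"
    and C: "0 \<le> C" and \<epsilon>: "0 < \<epsilon>"
  shows "\<forall>\<^sub>F k in sequentially. \<forall>\<tau> E. \<bar>\<tau>\<bar> \<le> T \<longrightarrow>
     0 \<le> E - ((1 - p k) + exp \<tau> * ((1 - p k) * u k)) \<longrightarrow>
     E - ((1 - p k) + exp \<tau> * ((1 - p k) * u k)) \<le> C * (p k)\<^sup>2 \<longrightarrow>
     \<bar>ln E - \<nu> * a k * (exp \<tau> - 1)\<bar> \<le> \<epsilon> * a k"
proof -
  \<comment> \<open>For \<open>\<bar>\<tau>\<bar> \<le> T\<close>, \<open>r k\<close> bounds the
    distance of \<open>E - 1\<close> from \<open>\<nu> * a k * (exp \<tau> - 1)\<close>, and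
    \<open>s k\<close> bounds \<open>\<bar>E - 1\<bar>\<close>. Then \<open>r k = o(a k)\<close>,
    while \<open>s k = O(a k)\<close>.\<close>
  define r where "r k = \<bar>p k - u k\<bar> + \<bar>p k * u k\<bar> * exp T + C * (p k)\<^sup>2 + \<bar>u k - \<nu> * a k\<bar> * (exp T + 1)" for k
  define s where "s k = \<nu> * a k * (exp T + 1) + r k" for k
  have ev: "\<forall>\<^sub>F k in sequentially. 0 < a k \<and> u k \<noteq> 0"
    using order_tendstoD(1)[OF u] eventually_ge_at_top[of 1]
    by eventually_elim (use a(1) in auto)
  have u0: "u \<longlonglongrightarrow> 0"
  proof (rule Lim_transform_eventually)
    show "(\<lambda>k. u k / a k * a k) \<longlonglongrightarrow> 0" using tendsto_mult[OF u(1) a(2)] by simp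
    show "\<forall>\<^sub>F k in sequentially. u k / a k * a k = u k" using ev by eventually_elim simp
  qed
  have pa: "(\<lambda>k. p k / a k) \<longlonglongrightarrow> \<nu>"
  proof (rule Lim_transform_eventually)
    show "(\<lambda>k. p k / u k * (u k / a k)) \<longlonglongrightarrow> \<nu>" using tendsto_mult[OF p u(1)] by simp
    show "\<forall>\<^sub>F k in sequentially. p k / u k * (u k / a k) = p k / a k" using ev by eventually_elim simp
  qed
  have p0: "p \<longlonglongrightarrow> 0"
  proof (rule Lim_transform_eventually)
    show "(\<lambda>k. p k / u k * u k) \<longlonglongrightarrow> 0" using tendsto_mult[OF p u0] by simp
    show "\<forall>\<^sub>F k in sequentially. p k / u k * u k = p k" using ev by eventually_elim simp
  qed
  have ra: "(\<lambda>k. r k / a k) \<longlonglongrightarrow> 0"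
  proof (rule Lim_transform_eventually)
    have "(\<lambda>k. \<bar>p k / a k - u k / a k\<bar> + \<bar>p k / a k * u k\<bar> * exp T + C * (p k / a k * p k)
        + \<bar>u k / a k - \<nu>\<bar> * (exp T + 1)) \<longlonglongrightarrow> \<bar>\<nu> - \<nu>\<bar> + \<bar>\<nu> * 0\<bar> * exp T + C * (\<nu> * 0) + \<bar>\<nu> - \<nu>\<bar> * (exp T + 1)"
      by (intro tendsto_intros pa u p0 u0)
    then show "(\<lambda>k. \<bar>p k / a k - u k / a k\<bar> + \<bar>p k / a k * u k\<bar> * exp T + C * (p k / a k * p k)
        + \<bar>u k / a k - \<nu>\<bar> * (exp T + 1)) \<longlonglongrightarrow> 0" by simp
    show "\<forall>\<^sub>F k in sequentially. \<bar>p k / a k - u k / a k\<bar> + \<bar>p k / a k * u k\<bar> * exp T + C * (p k / a k * p k)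
        + \<bar>u k / a k - \<nu>\<bar> * (exp T + 1) = r k / a k"
      using ev
    proof eventually_elim
      case (elim k)
      have 1: "\<bar>p k / a k - u k / a k\<bar> = \<bar>p k - u k\<bar> / a k"
        using elim by (simp add: abs_divide flip: diff_divide_distrib)
      have 2: "\<bar>p k / a k * u k\<bar> = \<bar>p k * u k\<bar> / a k" using elim by (simp add: abs_mult)
      have "u k / a k - \<nu> = (u k - \<nu> * a k) / a k" using elim by (simp add: field_simps)
      then have 3: "\<bar>u k / a k - \<nu>\<bar> = \<bar>u k - \<nu> * a k\<bar> / a k" using elim by (simp add: abs_divide)
      show ?case unfolding 1 2 3 r_def by (simp add: add_divide_distrib power2_eq_square)
    qed
  qed
  have sa: "(\<lambda>k. s k / a k) \<longlonglongrightarrow> \<nu> * (exp T + 1)"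
  proof (rule Lim_transform_eventually)
    show "(\<lambda>k. \<nu> * (exp T + 1) + r k / a k) \<longlonglongrightarrow> \<nu> * (exp T + 1)" using tendsto_add[OF tendsto_const ra] by simp
    show "\<forall>\<^sub>F k in sequentially. \<nu> * (exp T + 1) + r k / a k = s k / a k"
      using ev by eventually_elim (simp add: s_def add_divide_distrib)
  qed
  have s0: "s \<longlonglongrightarrow> 0"
  proof (rule Lim_transform_eventually)
    show "(\<lambda>k. s k / a k * a k) \<longlonglongrightarrow> 0" using tendsto_mult[OF sa a(2)] by simp
    show "\<forall>\<^sub>F k in sequentially. s k / a k * a k = s k" using ev by eventually_elim simp
  qed
  \<comment> \<open>Total error relative to \<open>a k\<close>: the linear part, and the quadratic
    part from replacing \<open>ln (1 + y)\<close> by \<open>y\<close>.\<close>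
  have "(\<lambda>k. r k / a k + 2 * (s k / a k * s k)) \<longlonglongrightarrow> 0 + 2 * (\<nu> * (exp T + 1) * 0)"
    by (intro tendsto_intros ra sa s0)
  then have "\<forall>\<^sub>F k in sequentially. r k / a k + 2 * (s k / a k * s k) < \<epsilon>"
    using \<epsilon> by (intro order_tendstoD) auto
  moreover have "\<forall>\<^sub>F k in sequentially. s k < 1 / 2" using s0 by (intro order_tendstoD) auto
  ultimately show ?thesis using ev
  proof eventually_elim
    case (elim k)
    show ?case
    proof (intro allI impI)
      fix \<tau> E
      assume \<tau>: "\<bar>\<tau>\<bar> \<le> T" and E: "0 \<le> E - ((1 - p k) + exp \<tau> * ((1 - p k) * u k))"
        "E - ((1 - p k) + exp \<tau> * ((1 - p k) * u k)) \<le> C * (p k)\<^sup>2"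
      have "exp \<tau> \<le> exp T" using \<tau> by simp
      then have e: "exp \<tau> \<le> exp T" "\<bar>exp \<tau> - 1\<bar> \<le> exp T + 1" using exp_gt_zero[of \<tau>] by linarith+
      define y where "y = E - 1"
      \<comment> \<open>The four summands match the four terms of \<open>r k\<close>:
        \<open>p\<close> against \<open>u\<close>, a product of second order, the mass above 1, and
        \<open>u\<close> against \<open>\<nu> * a\<close>.\<close>
      have "y - \<nu> * a k * (exp \<tau> - 1) = (u k - p k) - p k * u k * exp \<tau>
          + (E - ((1 - p k) + exp \<tau> * ((1 - p k) * u k))) + (u k - \<nu> * a k) * (exp \<tau> - 1)"
        by (simp add: y_def algebra_simps)
      moreover have "\<bar>p k * u k * exp \<tau>\<bar> \<le> \<bar>p k * u k\<bar> * exp T"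
        unfolding abs_mult[of "p k * u k"] using e by (intro mult_left_mono) auto
      moreover have "\<bar>(u k - \<nu> * a k) * (exp \<tau> - 1)\<bar> \<le> \<bar>u k - \<nu> * a k\<bar> * (exp T + 1)"
        unfolding abs_mult using e by (intro mult_left_mono) auto
      ultimately have y1: "\<bar>y - \<nu> * a k * (exp \<tau> - 1)\<bar> \<le> r k"
        unfolding r_def using E by linarith
      have "\<bar>\<nu> * a k * (exp \<tau> - 1)\<bar> \<le> \<nu> * a k * (exp T + 1)"
        unfolding abs_mult using e u(2) elim(3) by (intro mult_mono) auto
      then have y2: "\<bar>y\<bar> \<le> s k" using y1 unfolding s_def by linarith
      then have "\<bar>ln (1 + y) - y\<bar> \<le> 2 * y\<^sup>2"
        using elim(2) by (intro abs_ln_one_plus_x_minus_x_bound) simp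
      also have "\<dots> \<le> 2 * (s k)\<^sup>2" using y2 abs_le_square_iff[of y "s k"] by simp
      finally have "\<bar>ln E - \<nu> * a k * (exp \<tau> - 1)\<bar> \<le> r k + 2 * (s k)\<^sup>2"
        using y1 by (simp add: y_def)
      also have "\<dots> = (r k / a k + 2 * (s k / a k * s k)) * a k"
        using elim(3) by (simp add: field_simps power2_eq_square)
      also have "\<dots> \<le> \<epsilon> * a k" using elim(1,3) by (intro mult_right_mono) auto
      finally show "\<bar>ln E - \<nu> * a k * (exp \<tau> - 1)\<bar> \<le> \<epsilon> * a k" .
    qed
  qed
qed


text \<open>Lipschitz bound on a symmetric interval, from the tangent inequality
  \<open>1 + z \<le> exp z\<close>.\<close>

lemma exp_diff_abs_le:
  fixes x y m :: real
  assumes "\<bar>x\<bar> \<le> m" "\<bar>y\<bar> \<le> m"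
  shows "\<bar>exp x - exp y\<bar> \<le> exp m * \<bar>x - y\<bar>"
proof -
  have le: "exp x - exp y \<le> exp m * (x - y)" if "y \<le> x" "x \<le> m" for x y
  proof -
    have "exp x - exp y = exp x * (1 - exp (y - x))" by (simp add: right_diff_distrib flip: exp_add)
    also have "\<dots> \<le> exp x * (x - y)"
    proof (rule mult_left_mono)
      have "1 + (y - x) \<le> exp (y - x)" by (rule exp_ge_add_one_self)
      then show "1 - exp (y - x) \<le> x - y" by linarith
    qed simp
    also have "\<dots> \<le> exp m * (x - y)" using that by (intro mult_right_mono) auto
    finally show ?thesis .
  qed
  show ?thesis using le[of y x] le[of x y] assms by (cases "y \<le> x") auto
qed

section \<open>The large deviation principle for the averages\<close>

theorem theorem3p2:
  fixes M :: "'w measure"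
    and \<phi> :: "nat \<Rightarrow> real"
    and \<nu> :: real
    and R :: "nat \<Rightarrow> 'w \<Rightarrow> nat"
    and q :: "nat \<Rightarrow> nat \<Rightarrow> real"
    and f :: "nat \<Rightarrow> real \<Rightarrow> real"
  assumes "prob_space M"
    and "\<And>n. 0 \<le> \<phi> n"
    and "strict_mono \<phi>"
    and "\<phi> 0 = 0"
    and "filterlim \<phi> at_top sequentially"
    and "(\<lambda>n. \<phi> n / \<phi> (n + 1)) \<longlonglongrightarrow> 1"
    and "antimono_on {1..} (\<lambda>n. \<phi> n - \<phi> (n - 1))"
    and "filterlim (L_sum \<phi>) at_top sequentially"
    and "0 < \<nu>"
    and "prob_space.indep_vars M (\<lambda>_. count_space UNIV) R {1..}"
    and "\<And>n j. 1 \<le> n \<Longrightarrow> q n j = measure M {\<omega> \<in> space M. R n \<omega> = j}"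
    and "\<And>n x. 1 \<le> n \<Longrightarrow> x \<in> {0..1} \<Longrightarrow> f n x \<in> {0..1}"
    and "uniformly_tangent_at_1 f"
    and "\<And>k. 1 \<le> k \<Longrightarrow> q k 0 = f k (pi_seq \<phi> \<nu> k)"
    and "\<And>k. 1 \<le> k \<Longrightarrow> q k 1 = f k (pi_seq \<phi> \<nu> k) * (1 - pi_seq \<phi> \<nu> k)"
    and "\<And>n \<theta>. 1 \<le> n \<Longrightarrow> 0 < \<theta> \<Longrightarrow> integrable M (\<lambda>\<omega>. exp (\<theta> * real (R n \<omega>)))"
    and "\<And>\<theta>::real. 0 < \<theta> \<Longrightarrow> \<exists>C>0. \<exists>k\<^sub>0\<ge>1. \<forall>k>k\<^sub>0.
           0 \<le> (SUP \<tau>\<in>{\<tau>. 0 < \<bar>\<tau>\<bar> \<and> \<bar>\<tau>\<bar> \<le> \<theta>}.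
                  ereal ((\<integral>\<omega>. exp (\<tau> * real (R k \<omega>)) \<partial>M) - (q k 0 + exp \<tau> * q k 1))) \<and>
           (SUP \<tau>\<in>{\<tau>. 0 < \<bar>\<tau>\<bar> \<and> \<bar>\<tau>\<bar> \<le> \<theta>}.
                  ereal ((\<integral>\<omega>. exp (\<tau> * real (R k \<omega>)) \<partial>M) - (q k 0 + exp \<tau> * q k 1)))
             \<le> ereal (C * (1 - q k 0)\<^sup>2)"
  shows "satisfies_LDP M (Z_seq \<phi> R) (L_sum \<phi>) (poisson_rate \<nu>)
       \<and> good_rate_function (poisson_rate \<nu>)"
proof -
  interpret prob_space M by fact
  interpret slowly_growing_concave \<phi> by unfold_locales fact+
  note \<nu> = \<open>0 < \<nu>\<close>
  have R[measurable]: "R k \<in> measurable M (count_space UNIV)" if "1 \<le> k" for k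
    using assms(10) that by (auto simp: indep_vars_def)
  define mgf where "mgf k \<tau> = (\<integral>\<omega>. exp (\<tau> * real (R k \<omega>)) \<partial>M)" for k \<tau>
  \<comment> \<open>For \<open>\<tau> \<le> 0\<close> the integrand is at most 1; positive
    parameters are covered by hypothesis (b).\<close>
  have int: "integrable M (\<lambda>\<omega>. exp (\<tau> * real (R k \<omega>)))" if k: "1 \<le> k" for k \<tau>
  proof (cases "0 < \<tau>")
    case False
    note [measurable] = R[OF k]
    show ?thesis
      by (rule Bochner_Integration.integrable_bound[OF integrable_const[of "1 :: real"]])
         (use False in \<open>auto simp: mult_nonpos_nonneg not_less\<close>)
  qed (use assms(16)[OF k] in auto)
  have mgf_pos: "0 < mgf k \<tau>" if "1 \<le> k" for k \<tau>
    unfolding mgf_def using int[OF that] by (rule expectation_greater) simp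

  define u where "u k = 1 - pi_seq \<phi> \<nu> k" for k
  define p where "p k = 1 - q k 0" for k
  have u: "(\<lambda>k. u k / a k) \<longlonglongrightarrow> \<nu>" unfolding u_def by (rule one_minus_pi_seq_asymp)
  have u_pos: "\<forall>\<^sub>F k in sequentially. 0 < u k"
    using order_tendstoD(1)[OF u \<nu>] eventually_ge_at_top[of 1]
    by eventually_elim (use a_pos in \<open>auto simp: zero_less_divide_iff dest: less_asym\<close>)
  have u_0: "u \<longlonglongrightarrow> 0"
  proof (rule Lim_transform_eventually)
    show "(\<lambda>k. u k / a k * a k) \<longlonglongrightarrow> 0" using tendsto_mult[OF u a_tendsto_0] by simp
    show "\<forall>\<^sub>F k in sequentially. u k / a k * a k = u k"
      using eventually_ge_at_top[of 1] by eventually_elim (use a_pos in force)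
  qed
  \<comment> \<open>Here \<open>p k = 1 - f k (1 - u k)\<close>. Both the function and the point
    vary with \<open>k\<close>, so the tangency has to be uniform; positivity of \<open>u k\<close>
    keeps the point below 1.\<close>
  have p: "(\<lambda>k. p k / u k) \<longlonglongrightarrow> 1"
  proof (rule tendstoI)
    fix \<epsilon> :: real assume "0 < \<epsilon>"
    then obtain \<delta> where \<delta>: "0 < \<delta>" "\<And>n x. 1 \<le> n \<Longrightarrow> x \<in> {0..1} \<Longrightarrow> 1 - \<delta> < x \<Longrightarrow> x < 1 \<Longrightarrow>
        \<bar>(f n x - 1) / (x - 1) - 1\<bar> < \<epsilon>"
      using assms(13) unfolding uniformly_tangent_at_1_def by meson
    have "\<forall>\<^sub>F k in sequentially. u k < \<delta>" using order_tendstoD(2)[OF u_0 \<delta>(1)] .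
    then show "\<forall>\<^sub>F k in sequentially. dist (p k / u k) 1 < \<epsilon>"
      using u_pos eventually_ge_at_top[of 1]
    proof eventually_elim
      case (elim k)
      have pi: "pi_seq \<phi> \<nu> k = 1 - u k" by (simp add: u_def)
      have "0 \<le> pi_seq \<phi> \<nu> k" by (simp add: pi_seq_def)
      then have "\<bar>(f k (1 - u k) - 1) / (1 - u k - 1) - 1\<bar> < \<epsilon>"
        using \<delta>(2)[of k "1 - u k"] elim pi by auto
      moreover have "(f k (1 - u k) - 1) / (1 - u k - 1) = p k / u k"
        using assms(14)[OF elim(3)] pi by (simp add: p_def minus_divide_left[symmetric] divide_simps)
      ultimately show ?case by (simp add: dist_real_def)
    qed
  qed

  have log_mgf: "\<forall>\<^sub>F k in sequentially. \<forall>\<tau>. \<bar>\<tau>\<bar> \<le> T \<longrightarrow>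
      \<bar>ln (mgf k \<tau>) - \<nu> * a k * (exp \<tau> - 1)\<bar> \<le> \<epsilon> * a k" if T: "0 < T" and \<epsilon>: "0 < \<epsilon>" for T \<epsilon> :: real
  proof -
    obtain C k\<^sub>0 where C: "0 < C" and k\<^sub>0: "\<And>k. k\<^sub>0 < k \<Longrightarrow>
        (SUP \<tau>\<in>{\<tau>. 0 < \<bar>\<tau>\<bar> \<and> \<bar>\<tau>\<bar> \<le> T}. ereal (mgf k \<tau> - (q k 0 + exp \<tau> * q k 1)))
          \<le> ereal (C * (1 - q k 0)\<^sup>2)"
      using assms(17)[OF T] unfolding mgf_def by blast
    have "\<forall>\<^sub>F k in sequentially. \<forall>\<tau> E. \<bar>\<tau>\<bar> \<le> T \<longrightarrow>
       0 \<le> E - ((1 - p k) + exp \<tau> * ((1 - p k) * u k)) \<longrightarrow>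
       E - ((1 - p k) + exp \<tau> * ((1 - p k) * u k)) \<le> C * (p k)\<^sup>2 \<longrightarrow>
       \<bar>ln E - \<nu> * a k * (exp \<tau> - 1)\<bar> \<le> \<epsilon> * a k"
      using C by (intro log_mgf_approx a_pos a_tendsto_0 u \<nu> p \<epsilon>) auto
    then show ?thesis using eventually_gt_at_top[of k\<^sub>0] eventually_ge_at_top[of 1]
    proof eventually_elim
      case (elim k)
      have q: "1 - p k = q k 0" "q k 0 * u k = q k 1"
        using assms(14,15)[OF elim(3)] by (auto simp: p_def u_def)
      show ?case
      proof (intro allI impI)
        fix \<tau> assume \<tau>: "\<bar>\<tau>\<bar> \<le> T"
        show "\<bar>ln (mgf k \<tau>) - \<nu> * a k * (exp \<tau> - 1)\<bar> \<le> \<epsilon> * a k"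
        \<comment> \<open>The supremum in hypothesis (c) leaves out \<open>\<tau> = 0\<close>, where
          the generating function is 1 and both terms vanish.\<close>
        proof (cases "\<tau> = 0")
          case True
          then show ?thesis using \<epsilon> a_pos[OF elim(3)] by (simp add: mgf_def prob_space)
        next
          case False
          have "q k 0 + exp \<tau> * q k 1 \<le> mgf k \<tau>"
            unfolding mgf_def assms(11)[OF elim(3)] by (rule mgf_nat_lower_bound[OF R int]) (use elim in auto)
          moreover have "ereal (mgf k \<tau> - (q k 0 + exp \<tau> * q k 1)) \<le> ereal (C * (1 - q k 0)\<^sup>2)"
            using False \<tau> by (intro order_trans[OF SUP_upper k\<^sub>0[OF elim(2)]]) auto
          ultimately show ?thesis
            using elim(1)[rule_format, of \<tau> "mgf k \<tau>"] \<tau> by (simp add: q p_def)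
        qed
      qed
    qed
  qed

  \<comment> \<open>The scaling by \<open>L_sum \<phi> n\<close> turns the exponential of
    \<open>Z_seq\<close> into a product over the independent variables, so its expectation
    factorises.\<close>
  have exp_Z: "exp (s * L_sum \<phi> n * Z_seq \<phi> R n \<omega>) = (\<Prod>j=1..n. exp (s * w n j * real (R j \<omega>)))"
    if "1 \<le> n" for n s \<omega>
  proof -
    have "s * L_sum \<phi> n * Z_seq \<phi> R n \<omega> = (\<Sum>j=1..n. s * w n j * real (R j \<omega>))"
      using L_sum_Z_seq[OF that, of R \<omega>] by (simp add: mult.assoc sum_distrib_left)
    then show ?thesis by (simp add: exp_sum)
  qed
  have indep: "indep_vars (\<lambda>_. borel) (\<lambda>j \<omega>. exp (s j * real (R j \<omega>))) {1..n}" for s :: "nat \<Rightarrow> real" and n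
    using indep_vars_subset[OF assms(10), of "{1..n}"]
    by (rule indep_vars_compose2[where Y = "\<lambda>j r. exp (s j * real r)"]) auto
  have int_Z: "integrable M (\<lambda>\<omega>. exp (s * L_sum \<phi> n * Z_seq \<phi> R n \<omega>))" if "1 \<le> n" for n s
    unfolding exp_Z[OF that] using indep by (intro indep_vars_integrable int) auto
  have mgf_Z: "(\<integral>\<omega>. exp (s * L_sum \<phi> n * Z_seq \<phi> R n \<omega>) \<partial>M) = (\<Prod>j=1..n. mgf j (s * w n j))" if "1 \<le> n" for n s
    unfolding exp_Z[OF that] mgf_def using indep by (intro indep_vars_lebesgue_integral int) auto

  have lim: "(\<lambda>n. ln (\<integral>\<omega>. exp (\<theta> * L_sum \<phi> n * Z_seq \<phi> R n \<omega>) \<partial>M) / L_sum \<phi> n)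
      \<longlonglongrightarrow> \<nu> * (exp \<theta> - 1)" for \<theta>
  proof -
    \<comment> \<open>All arguments \<open>\<theta> * w n j\<close> lie in \<open>[-T, T]\<close>
      because \<open>w n j \<le> 2\<close>; the summand 1 makes \<open>T\<close> positive for
      \<open>\<theta> = 0\<close>.\<close>
    define T where "T = 2 * \<bar>\<theta>\<bar> + 1"
    have arg: "\<bar>\<theta> * x\<bar> \<le> T" if "\<bar>x\<bar> \<le> 2" for x
      using mult_left_mono[OF that, of "\<bar>\<theta>\<bar>"] by (simp add: abs_mult T_def)
    define g where "g n j = ln (mgf j (\<theta> * w n j)) - \<nu> * a j * (exp (\<theta> * w n j) - 1)" for n j
    \<comment> \<open>As \<open>R j\<close> is nonnegative, values of \<open>mgf j\<close> on
      \<open>[-T, T]\<close> lie between those at the endpoints. This gives the bound on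
      \<open>g n j\<close> independent of \<open>n\<close>.\<close>
    have mgf_mono: "mgf j s \<le> mgf j t" if "1 \<le> j" "s \<le> t" for j s t
      unfolding mgf_def using that by (intro integral_mono int) (auto intro: mult_right_mono)
    have "(\<lambda>n. (\<Sum>j=1..n. g n j) / (\<Sum>j=1..n. a j)) \<longlonglongrightarrow> 0"
    proof (rule weighted_average_tendsto_0
        [where b = "\<lambda>j. \<bar>ln (mgf j T)\<bar> + \<bar>ln (mgf j (- T))\<bar> + \<nu> * (exp T + 1)"])
      fix n j :: nat assume j: "1 \<le> j" "j \<le> n"
      have t: "- T \<le> \<theta> * w n j" "\<theta> * w n j \<le> T" using arg[OF w_bounds(1)[OF j]] by auto
      have "ln (mgf j (- T)) \<le> ln (mgf j (\<theta> * w n j))" "ln (mgf j (\<theta> * w n j)) \<le> ln (mgf j T)"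
        using mgf_mono[OF j(1)] t mgf_pos[OF j(1)] by (auto intro: ln_mono)
      moreover have "\<bar>\<nu> * a j * (exp (\<theta> * w n j) - 1)\<bar> \<le> \<nu> * (exp T + 1)"
      proof -
        have "exp (\<theta> * w n j) \<le> exp T" using t by simp
        then have "\<bar>exp (\<theta> * w n j) - 1\<bar> \<le> exp T + 1" using exp_gt_zero[of "\<theta> * w n j"] by linarith
        moreover have "\<bar>\<nu> * a j\<bar> \<le> \<nu>"
          using \<nu> a_pos[OF j(1)] a_le_1[OF j(1)] by (simp add: abs_mult mult_left_le)
        ultimately show ?thesis unfolding abs_mult[of "\<nu> * a j"] using \<nu> by (intro mult_mono) auto
      qed
      ultimately show "\<bar>g n j\<bar> \<le> \<bar>ln (mgf j T)\<bar> + \<bar>ln (mgf j (- T))\<bar> + \<nu> * (exp T + 1)"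
        unfolding g_def by linarith
    next
      fix \<epsilon> :: real assume "0 < \<epsilon>"
      then have "\<forall>\<^sub>F j in sequentially. \<forall>\<tau>. \<bar>\<tau>\<bar> \<le> T \<longrightarrow>
          \<bar>ln (mgf j \<tau>) - \<nu> * a j * (exp \<tau> - 1)\<bar> \<le> \<epsilon> * a j"
        by (intro log_mgf) (auto simp: T_def)
      then show "\<forall>\<^sub>F j in sequentially. \<forall>n\<ge>j. \<bar>g n j\<bar> \<le> \<epsilon> * a j"
        using eventually_ge_at_top[of 1]
        by eventually_elim (use arg w_bounds(1) in \<open>auto simp: g_def\<close>)
    qed (use a_pos L_at_top in \<open>auto simp: less_imp_le L_sum_eq[abs_def]\<close>)
    then have g: "(\<lambda>n. (\<Sum>j=1..n. g n j) / L_sum \<phi> n) \<longlonglongrightarrow> 0" by (simp only: L_sum_eq)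
    \<comment> \<open>With the error \<open>g\<close> removed, the main term is an average of
      \<open>h (w n j)\<close> with weights \<open>a j\<close>, and it tends to
      \<open>h 1\<close>.\<close>
    define h where "h x = \<nu> * (exp (\<theta> * x) - 1)" for x
    have "(\<lambda>n. (\<Sum>j=1..n. a j * h (w n j)) / L_sum \<phi> n) \<longlonglongrightarrow> h 1"
    proof (rule weighted_average_w_tendsto)
      fix x :: real assume x: "0 \<le> x" "x \<le> 2"
      have "\<bar>h x - h 1\<bar> = \<nu> * \<bar>exp (\<theta> * x) - exp (\<theta> * 1)\<bar>"
        using \<nu> by (simp add: h_def abs_mult flip: right_diff_distrib)
      also have "\<dots> \<le> \<nu> * (exp T * \<bar>\<theta> * x - \<theta> * 1\<bar>)"
        using \<nu> x by (intro mult_left_mono exp_diff_abs_le arg) auto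
      also have "\<dots> = \<nu> * exp T * \<bar>\<theta>\<bar> * \<bar>x - 1\<bar>"
        by (simp only: right_diff_distrib[symmetric] abs_mult mult.assoc)
      finally show "\<bar>h x - h 1\<bar> \<le> \<nu> * exp T * \<bar>\<theta>\<bar> * \<bar>x - 1\<bar>" .
    qed
    from tendsto_add[OF g this] have "(\<lambda>n. ((\<Sum>j=1..n. g n j) + (\<Sum>j=1..n. a j * h (w n j))) / L_sum \<phi> n)
        \<longlonglongrightarrow> \<nu> * (exp \<theta> - 1)"
      by (simp add: add_divide_distrib h_def)
    then show ?thesis
    proof (rule Lim_transform_eventually)
      show "\<forall>\<^sub>F n in sequentially. ((\<Sum>j=1..n. g n j) + (\<Sum>j=1..n. a j * h (w n j))) / L_sum \<phi> n
          = ln (\<integral>\<omega>. exp (\<theta> * L_sum \<phi> n * Z_seq \<phi> R n \<omega>) \<partial>M) / L_sum \<phi> n"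
        using eventually_ge_at_top[of 1]
      proof eventually_elim
        case (elim n)
        have "ln (\<Prod>j=1..n. mgf j (\<theta> * w n j)) = (\<Sum>j=1..n. ln (mgf j (\<theta> * w n j)))"
          by (rule ln_prod) (auto simp: less_imp_neq[OF mgf_pos, symmetric])
        also have "\<dots> = (\<Sum>j=1..n. g n j) + (\<Sum>j=1..n. a j * h (w n j))"
          unfolding sum.distrib[symmetric] by (simp add: g_def h_def)
        finally show ?case by (simp add: mgf_Z[OF elim])
      qed
    qed
  qed

  have "satisfies_LDP M (Z_seq \<phi> R) (L_sum \<phi>) (poisson_rate \<nu>)"
  proof (rule LDP_poisson_rate[OF \<nu> _ _ _ L_at_top lim])
    fix n :: nat assume n: "1 \<le> n"
    have Rb: "(\<lambda>\<omega>. real (R k \<omega>)) \<in> borel_measurable M" if "1 \<le> k" for k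
      using R[OF that] by simp
    show "Z_seq \<phi> R n \<in> borel_measurable M"
      unfolding Z_seq_def[abs_def] W_seq_def using Rb
      by (intro borel_measurable_times borel_measurable_sum borel_measurable_const) auto
    show "0 \<le> Z_seq \<phi> R n \<omega>" for \<omega>
    proof -
      have "0 \<le> (\<Sum>j=1..n. w n j * real (R j \<omega>))"
        by (intro sum_nonneg mult_nonneg_nonneg) (auto intro!: less_imp_le[OF w_pos])
      then show ?thesis
        using L_sum_Z_seq[OF n, of R \<omega>] L_sum_pos[OF n] by (metis zero_le_mult_iff less_le_not_le)
    qed
    show "integrable M (\<lambda>\<omega>. exp (s * Z_seq \<phi> R n \<omega>))" for s
      using int_Z[OF n, of "s / L_sum \<phi> n"] L_sum_pos[OF n] by simp
  qed
  then show ?thesis using good_rate_function_poisson_rate[OF \<nu>] by blast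
qed

end
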